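(* Assume that $p(\cdot\,|x,a)$ is continuous in $(x,a)\in\mathsf X\times\mathsf A$ with respect to total variation distance, and that there exist a probability measure $\lambda$ on $\mathsf X$, a constant $\alpha\in(0,1)$ and a bounded measurable $\phi:\mathsf X\times\mathsf A\to\mathbb R$ such that $p(D|x,a)\ge\lambda(D)\phi(x,a)$ for all Borel $D\subset\mathsf X$ and $1-\alpha\le\phi(x,a)$, for all $(x,a)\in\mathsf X\times\mathsf A$. Then, for the average cost criterion, $$\lim_{n\to\infty}\bigl|\min(\mathbf{CP}_n^{\mathbf k})-\min(\mathbf{CP}^{\mathbf k})\bigr|=0 .$$
   Context: **Model.** $\mathsf X$ (states) and $\mathsf A$ (actions) are compact metric spaces with their Borel $\sigma$-algebras; $d_{\mathsf X}$ is the metric of $\mathsf X$; every action is admissible in every state. $p(\cdot\,|x,a)$ is a stochastic kernel on $\mathsf X$ given $\mathsf X\times\mathsf A$; $c,d_1,\dots,d_q:\mathsf X\times\mathsf A\to[0,\infty)$ are continuous; $\gamma$ is a probability measure on $\mathsf X$ (initial distribution); $\mathbf k=(k_1,\dots,k_q)\in[0,\infty)^q$. A policy $\pi=\{\pi_t\}$ is a sequence of stochastic kernels on $\mathsf A$ given the history spaces $\mathsf H_t=(\mathsf X\times\mathsf A)^t\times\mathsf X$; $\Pi$ is the set of all policies. $\mathbb E_\gamma^\pi$ is expectation under the law of $(X_t,A_t)_{t\ge0}$ determined by $\gamma$, $\pi$, $p$. **Average criterion.** $V(\pi,\gamma)=\limsup_{T\to\infty}\frac1T\mathbb E_\gamma^\pi[\sum_{t=0}^{T-1}c(X_t,A_t)]$,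 and $V_l(\pi,\gamma)$ is the same with $d_l$ in place of $c$. $(\mathbf{CP}^{\mathbf k})$: minimize $V(\pi,\gamma)$ over $\pi\in\Pi$ subject to $V_l(\pi,\gamma)\le k_l$, $l=1,\dots,q$. Standing assumption: there is $\pi\in\Pi$ with $V_l(\pi,\gamma)<k_l$ for all $l$. **Finite models.** For each $n\ge1$ let $\mathsf X_n=\{x_{n,1},\dots,x_{n,k_n}\}\subset\mathsf X$ be finite with $\min_i d_{\mathsf X}(x,x_{n,i})<1/n$ for all $x\in\mathsf X$; $Q_n:\mathsf X\to\mathsf X_n$ is a nearest-point map (ties broken so that $Q_n$ is measurable); $\mathcal S_{n,i}=Q_n^{-1}(x_{n,i})$. Let $\nu_n$ be a finite measure on $\mathsf X$ with $\nu_n(\mathcal S_{n,i})>0$ for all $i$, and let $\nu_{n,i}(\cdot)=\nu_n(\cdot)/\nu_n(\mathcal S_{n,i})$ on $\mathcal S_{n,i}$. MDP$_n$ has state space $\mathsf X_n$, action space $\mathsf A$, initial distribution $\gamma_n=\gamma\circ Q_n^{-1}$, and $p_n(x_{n,j}|x_{n,i},a)=\int_{\mathcal S_{n,i}}p(\mathcal S_{n,j}|x,a)\,\nu_{n,i}(dx)$, $c_n(x_{n,i},a)=\int_{\mathcal S_{n,i}}c(x,a)\,\nu_{n,i}(dx)$, $d_{l,n}(x_{n,i},a)=\int_{\mathcal S_{n,i}}d_l(x,a)\,\nu_{n,i}(dx)$. Its policies $\Pi_n$ and average costs $V_n,V_{l,n}$ (for $c_n,d_{l,n}$) are defined as for the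 original model. $(\mathbf{CP}_n^{\mathbf k})$: minimize $V_n(\pi,\gamma_n)$ over $\pi\in\Pi_n$ subject to $V_{l,n}(\pi,\gamma_n)\le k_l$ for all $l$. $\min(\cdot)$ denotes the optimal value of a problem (with value $+\infty$ if it is infeasible). *)

theory Defs
  imports "HOL-Probability.Probability"
begin

(* A compact metric space is rendered as a type of sort polish_space with compact UNIV. The sort is
   no extra hypothesis, since compact metric spaces are complete and separable; it makes the Borel
   sigma-algebra of a product the product of the Borel sigma-algebras. *)

(* A history in (X x A)^t x X is a pair (omega, x), where omega is an element of the product space
   with index set {0..<t} listing the past state-action pairs and x is the current state.
   S is the state space as a measurable space: borel for the original model, a finite count_space
   for a finite model. *)
definition history_space ::
    "'x measure \<Rightarrow> nat \<Rightarrow> ((nat \<Rightarrow> 'x \<times> 'a::topological_space) \<times> 'x) measure" where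
  "history_space S t = (\<Pi>\<^sub>M i\<in>{0..<t}. S \<Otimes>\<^sub>M borel) \<Otimes>\<^sub>M S"

type_synonym ('x, 'a) policy = "nat \<Rightarrow> (nat \<Rightarrow> 'x \<times> 'a) \<times> 'x \<Rightarrow> 'a measure"

definition policies :: "'x measure \<Rightarrow> ('x, 'a::topological_space) policy set" where
  "policies S = {\<pi>. \<forall>t. \<pi> t \<in> history_space S t \<rightarrow>\<^sub>M prob_algebra borel}"

(* Conditional law of (X_t, A_t) given the first t state-action pairs omega. *)
definition step_kernel ::
    "'x measure \<Rightarrow> 'x measure \<Rightarrow> ('x \<times> 'a::topological_space \<Rightarrow> 'x measure) \<Rightarrow> ('x, 'a) policy
      \<Rightarrow> nat \<Rightarrow> (nat \<Rightarrow> 'x \<times> 'a) \<Rightarrow> ('x \<times> 'a) measure" where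
  "step_kernel S \<gamma> p \<pi> t \<omega> =
     (if t = 0 then \<gamma> else p (\<omega> (t - 1))) \<bind>
       (\<lambda>x. \<pi> t (\<omega>, x) \<bind> (\<lambda>a. return (S \<Otimes>\<^sub>M borel) (x, a)))"

(* Law of the whole process (X_t, A_t), t = 0, 1, ..., by the Ionescu-Tulcea theorem. *)
definition trajectory_law ::
    "'x measure \<Rightarrow> 'x measure \<Rightarrow> ('x \<times> 'a::topological_space \<Rightarrow> 'x measure) \<Rightarrow> ('x, 'a) policy
      \<Rightarrow> (nat \<Rightarrow> 'x \<times> 'a) measure" where
  "trajectory_law S \<gamma> p \<pi> =
     projective_family.lim UNIV
       (Ionescu_Tulcea.CI (step_kernel S \<gamma> p \<pi>) (\<lambda>_. S \<Otimes>\<^sub>M borel)) (\<lambda>_. S \<Otimes>\<^sub>M borel)"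

definition average_cost ::
    "'x measure \<Rightarrow> 'x measure \<Rightarrow> ('x \<times> 'a::topological_space \<Rightarrow> 'x measure)
      \<Rightarrow> ('x \<times> 'a \<Rightarrow> real) \<Rightarrow> ('x, 'a) policy \<Rightarrow> ereal" where
  "average_cost S \<gamma> p c \<pi> =
     limsup (\<lambda>T. ereal (1 / real T * (\<integral>\<omega>. (\<Sum>t<T. c (\<omega> t)) \<partial>trajectory_law S \<gamma> p \<pi>)))"

(* The infimum is taken in ereal, so it is infinite for an infeasible problem. *)
definition constrained_value ::
    "'x measure \<Rightarrow> 'x measure \<Rightarrow> ('x \<times> 'a::topological_space \<Rightarrow> 'x measure)
      \<Rightarrow> ('x \<times> 'a \<Rightarrow> real) \<Rightarrow> nat \<Rightarrow> (nat \<Rightarrow> 'x \<times> 'a \<Rightarrow> real) \<Rightarrow> (nat \<Rightarrow> real) \<Rightarrow> ereal" where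
  "constrained_value S \<gamma> p c q d k =
     (INF \<pi> \<in> {\<pi> \<in> policies S. \<forall>l\<in>{1..q}. average_cost S \<gamma> p (d l) \<pi> \<le> ereal (k l)}.
        average_cost S \<gamma> p c \<pi>)"

(* For measures on the same sigma-algebra, normalised as the norm of the signed measure M - N. *)
definition tv_dist :: "'x measure \<Rightarrow> 'x measure \<Rightarrow> real" where
  "tv_dist M N = 2 * (SUP D\<in>sets M. \<bar>measure M D - measure N D\<bar>)"

definition tv_continuous :: "('z::topological_space \<Rightarrow> 'x measure) \<Rightarrow> bool" where
  "tv_continuous p \<longleftrightarrow> (\<forall>z. ((\<lambda>z'. tv_dist (p z') (p z)) \<longlongrightarrow> 0) (at z))"

definition nearest_point_map :: "'x::metric_space set \<Rightarrow> ('x \<Rightarrow> 'x) \<Rightarrow> bool" where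
  "nearest_point_map F Q \<longleftrightarrow>
     Q \<in> borel \<rightarrow>\<^sub>M count_space F \<and> (\<forall>x. \<forall>y\<in>F. dist x (Q x) \<le> dist x y)"

(* uniform_measure nu B is nu restricted to B and divided by nu B, for any measure nu. *)
definition cell_measure :: "('x \<Rightarrow> 'x) \<Rightarrow> 'x measure \<Rightarrow> 'x \<Rightarrow> 'x measure" where
  "cell_measure Q \<nu> y = uniform_measure \<nu> (Q -` {y})"

definition finite_kernel ::
    "'x set \<Rightarrow> ('x \<Rightarrow> 'x) \<Rightarrow> 'x measure \<Rightarrow> ('x \<times> 'a \<Rightarrow> 'x measure) \<Rightarrow> 'x \<times> 'a \<Rightarrow> 'x measure" where
  "finite_kernel F Q \<nu> p = (\<lambda>(y, a).
     point_measure F (\<lambda>y'. ennreal (\<integral>x. measure (p (x, a)) (Q -` {y'}) \<partial>cell_measure Q \<nu> y)))"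

definition finite_cost ::
    "('x \<Rightarrow> 'x) \<Rightarrow> 'x measure \<Rightarrow> ('x \<times> 'a \<Rightarrow> real) \<Rightarrow> 'x \<times> 'a \<Rightarrow> real" where
  "finite_cost Q \<nu> c = (\<lambda>(y, a). \<integral>x. c (x, a) \<partial>cell_measure Q \<nu> y)"

definition finite_initial :: "'x set \<Rightarrow> ('x \<Rightarrow> 'x) \<Rightarrow> 'x measure \<Rightarrow> 'x measure" where
  "finite_initial F Q \<gamma> = distr \<gamma> (count_space F) Q"

(* projective_family.lim and Ionescu_Tulcea.CI carry their meaning only under their locale
   assumptions; Ionescu_Tulcea_step_kernel below shows that these hold. *)
lemma step_kernel_measurable:
  fixes S :: "'x measure" and p :: "'x \<times> 'a::topological_space \<Rightarrow> 'x measure"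
  assumes \<gamma>: "\<gamma> \<in> space (prob_algebra S)"
    and p: "p \<in> S \<Otimes>\<^sub>M borel \<rightarrow>\<^sub>M prob_algebra S"
    and \<pi>: "\<pi> \<in> policies S"
  shows "step_kernel S \<gamma> p \<pi> t \<in>
    (\<Pi>\<^sub>M i\<in>{0..<t}. S \<Otimes>\<^sub>M borel) \<rightarrow>\<^sub>M prob_algebra (S \<Otimes>\<^sub>M (borel :: 'a measure))"
proof -
  have pi_t: "\<pi> t \<in> (\<Pi>\<^sub>M i\<in>{0..<t}. S \<Otimes>\<^sub>M borel) \<Otimes>\<^sub>M S \<rightarrow>\<^sub>M prob_algebra borel"
    using \<pi> by (simp add: policies_def history_space_def)
  have state: "(\<lambda>\<omega>. if t = 0 then \<gamma> else p (\<omega> (t - 1))) \<in>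
      (\<Pi>\<^sub>M i\<in>{0..<t}. S \<Otimes>\<^sub>M (borel :: 'a measure)) \<rightarrow>\<^sub>M prob_algebra S"
  proof (cases "t = 0")
    case True
    then show ?thesis using \<gamma> by simp
  next
    case False
    then have "(\<lambda>\<omega>. p (\<omega> (t - 1))) \<in> (\<Pi>\<^sub>M i\<in>{0..<t}. S \<Otimes>\<^sub>M borel) \<rightarrow>\<^sub>M prob_algebra S"
      by (intro measurable_compose[OF _ p] measurable_component_singleton) auto
    with False show ?thesis by simp
  qed
  have "(\<lambda>(\<omega>, x). \<pi> t (\<omega>, x) \<bind> (\<lambda>a. return (S \<Otimes>\<^sub>M borel) (x, a))) \<in>
      (\<Pi>\<^sub>M i\<in>{0..<t}. S \<Otimes>\<^sub>M borel) \<Otimes>\<^sub>M S \<rightarrow>\<^sub>M prob_algebra (S \<Otimes>\<^sub>M (borel :: 'a measure))"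
    unfolding split_beta'
    by (rule measurable_bind_prob_space2[where N = borel])
       (use pi_t in \<open>auto simp: split_beta' intro!: measurable_compose[OF _ measurable_return_prob_space]\<close>)
  then show ?thesis
    unfolding step_kernel_def by (intro measurable_bind_prob_space2[OF state])
qed

lemma Ionescu_Tulcea_step_kernel:
  fixes S :: "'x measure" and p :: "'x \<times> 'a::topological_space \<Rightarrow> 'x measure"
  assumes "\<gamma> \<in> space (prob_algebra S)"
    and "p \<in> S \<Otimes>\<^sub>M borel \<rightarrow>\<^sub>M prob_algebra S"
    and "\<pi> \<in> policies S"
  shows "Ionescu_Tulcea (step_kernel S \<gamma> p \<pi>) (\<lambda>_. S \<Otimes>\<^sub>M (borel :: 'a measure))"
proof (rule Ionescu_Tulcea.intro)
  show "step_kernel S \<gamma> p \<pi> i \<in>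
      (\<Pi>\<^sub>M i\<in>{0..<i}. S \<Otimes>\<^sub>M borel) \<rightarrow>\<^sub>M subprob_algebra (S \<Otimes>\<^sub>M borel)" for i
    using step_kernel_measurable[OF assms] by (rule measurable_prob_algebraD)
  fix i :: nat and \<omega>
  assume "\<omega> \<in> space (\<Pi>\<^sub>M i\<in>{0..<i}. S \<Otimes>\<^sub>M (borel :: 'a measure))"
  from measurable_space[OF step_kernel_measurable[OF assms] this]
  show "prob_space (step_kernel S \<gamma> p \<pi> i \<omega>)"
    by (simp add: space_prob_algebra)
qed

end

theory Submission
  imports Defs
begin

text \<open>The proof compares the two models through measures on the finite set of cells times the action
space, never through weak limits.

From a policy to a measure. Average the laws of \<open>(X\<^sub>t, A\<^sub>t)\<close> over \<open>t < T\<close>. By telescoping, the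
resulting occupation measure is invariant under the transition law up to \<open>2 / T\<close>, and for large
\<open>T\<close> its integrals of the finitely many costs exceed the average costs by as little as desired
(\<open>occupation_of_policy\<close>). An approximate invariance is all that is used below, so no limit point
has to be taken.

From a measure to a policy. Let \<open>\<mu>\<close> be a measure on cells times actions whose invariance fails by at
most \<open>\<eta>\<close>. Conditioning \<open>\<mu>\<close> on the cell, which on a finite set is elementary, gives a
stationary policy. Doeblin's condition makes one step of the cell chain an \<open>\<alpha>\<close>-contraction for the
\<open>l\<^sup>1\<close> distance, so the law of the cell approaches the cell marginal of \<open>\<mu>\<close> up to
\<open>\<eta> / (1 - \<alpha>)\<close>, whatever the initial law, and the average cost is correspondingly close
to the integral of the cost against \<open>\<mu>\<close> (\<open>average_cost_lumped_policy\<close>).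

Why both models are alike. By compactness the transition law is uniformly continuous in total
variation and the costs are uniformly continuous. Hence, for fine cells, the original model seen
through the nearest-point map moves like a controlled Markov chain on the cells, up to an error \<open>\<epsilon>\<close> per step, and the
reference transition law of this chain can be taken to be that of the finite model. The finite
model has the same reference law with no error. Both translations above therefore hold, with the same
reference chain, for the original and for the finite model, and so a policy of one model becomes a
policy of the other with all costs changed by at most a constant times \<open>\<epsilon>\<close> (\<open>transfer_policy\<close>).

Why the constraints survive. The transfer may violate a constraint by \<open>O(\<epsilon>)\<close>. Before conditioning,
the occupation measure is mixed with a weight \<open>\<theta>\<close> of one coming from the strictly feasible policy.
Costs are linear on measures, so this gains \<open>\<theta> \<delta>\<close> in every constraint and loses at most
\<open>\<theta> C\<close> in the objective (\<open>constrained_value_transfer\<close>). Choosing \<open>\<theta>\<close> small first and then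
\<open>\<epsilon>\<close> small compared with \<open>\<theta> \<delta>\<close> gives both inequalities between the optimal values.\<close>

section \<open>Integration against probability kernels\<close>

lemma space_eq_of_prob_algebra: "M \<in> space (prob_algebra N) \<Longrightarrow> space M = space N"
  by (auto simp: space_prob_algebra dest: sets_eq_imp_space_eq)

lemma integrable_prob_space_bounded:
  fixes f :: "'b \<Rightarrow> real"
  assumes "M \<in> space (prob_algebra N)" and "f \<in> borel_measurable N"
    and "\<And>x. x \<in> space N \<Longrightarrow> \<bar>f x\<bar> \<le> B"
  shows "integrable M f"
proof -
  have M: "prob_space M" "sets M = sets N"
    using assms(1) by (auto simp: space_prob_algebra)
  interpret prob_space M by (fact M)
  have "f \<in> borel_measurable M"
    using assms(2) by (simp cong: measurable_cong_sets add: M(2))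
  then show ?thesis
    using assms(3) sets_eq_imp_space_eq[OF M(2)] by (intro integrable_const_bound[where B = B]) auto
qed

lemma integral_bind_prob_algebra:
  fixes f :: "'c \<Rightarrow> real"
  assumes "M \<in> space (prob_algebra L)" and "K \<in> L \<rightarrow>\<^sub>M prob_algebra N"
    and "f \<in> borel_measurable N" and "\<And>x. x \<in> space N \<Longrightarrow> \<bar>f x\<bar> \<le> B"
  shows "(\<integral>x. f x \<partial>(M \<bind> K)) = (\<integral>x. (\<integral>y. f y \<partial>K x) \<partial>M)"
proof -
  have M: "prob_space M" "sets M = sets L"
    using assms(1) by (auto simp: space_prob_algebra)
  then interpret prob_space M by simp
  have K: "K \<in> M \<rightarrow>\<^sub>M subprob_algebra N"
    using measurable_prob_algebraD[OF assms(2)] by (simp cong: measurable_cong_sets add: M(2))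
  show ?thesis
  proof (rule integral_bind[OF assms(3) assms(4) K, where B' = 1])
    show "AE x in M. emeasure (K x) (space (K x)) \<le> ennreal 1"
      using measurable_space[OF K] by (auto simp: space_subprob_algebra intro: subprob_space.emeasure_space_le_1)
  qed unfold_locales
qed

lemma bind_in_prob_algebra:
  assumes "M \<in> space (prob_algebra L)" and "K \<in> L \<rightarrow>\<^sub>M prob_algebra N"
  shows "M \<bind> K \<in> space (prob_algebra N)"
  using prob_space_bind'[OF assms] sets_bind'[OF assms] by (simp add: space_prob_algebra)

lemma distr_in_prob_algebra:
  assumes "M \<in> space (prob_algebra L)" and "f \<in> L \<rightarrow>\<^sub>M N"
  shows "distr M N f \<in> space (prob_algebra N)"
  using measurable_space[OF measurable_distr_prob_space[OF assms(2)] assms(1)] .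

lemma distr_bind_prob_algebra:
  assumes "M \<in> space (prob_algebra L)" and "K \<in> L \<rightarrow>\<^sub>M prob_algebra N" and "f \<in> N \<rightarrow>\<^sub>M R"
  shows "distr (M \<bind> K) R f = M \<bind> (\<lambda>x. distr (K x) R f)"
proof (rule distr_bind[OF _ _ assms(3)])
  show "K \<in> M \<rightarrow>\<^sub>M subprob_algebra N"
    using measurable_prob_algebraD[OF assms(2)] assms(1)
    by (simp cong: measurable_cong_sets add: space_prob_algebra)
  show "space M \<noteq> {}"
    using assms(1) by (auto simp: space_prob_algebra dest: prob_space.not_empty)
qed

lemma bind_assoc_prob_algebra:
  assumes "M \<in> space (prob_algebra L)" and "f \<in> L \<rightarrow>\<^sub>M prob_algebra N" and "g \<in> N \<rightarrow>\<^sub>M prob_algebra R"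
  shows "M \<bind> f \<bind> g = M \<bind> (\<lambda>x. f x \<bind> g)"
proof (rule bind_assoc)
  show "f \<in> M \<rightarrow>\<^sub>M subprob_algebra N"
    using measurable_prob_algebraD[OF assms(2)] assms(1)
    by (simp cong: measurable_cong_sets add: space_prob_algebra)
qed (use assms(3) in \<open>rule measurable_prob_algebraD\<close>)

section \<open>State-action laws of a controlled process\<close>

locale mdp =
  fixes S :: "'x measure" and \<gamma> :: "'x measure"
    and p :: "'x \<times> 'a::topological_space \<Rightarrow> 'x measure"
  assumes initial: "\<gamma> \<in> space (prob_algebra S)"
    and kernel: "p \<in> S \<Otimes>\<^sub>M borel \<rightarrow>\<^sub>M prob_algebra S"
begin

abbreviation pairs :: "('x \<times> 'a) measure" where
  "pairs \<equiv> S \<Otimes>\<^sub>M borel"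

text \<open>Only the one-time laws \<open>pair_law\<close> of \<open>(X\<^sub>t, A\<^sub>t)\<close> enter the average cost. The law of the whole history
is an auxiliary device: it is what the conditional law of the next pair is integrated against.\<close>
definition pair_law :: "('x, 'a) policy \<Rightarrow> nat \<Rightarrow> ('x \<times> 'a) measure" where
  "pair_law \<pi> t = distr (trajectory_law S \<gamma> p \<pi>) pairs (\<lambda>\<omega>. \<omega> t)"

definition state_law :: "('x, 'a) policy \<Rightarrow> nat \<Rightarrow> 'x measure" where
  "state_law \<pi> t = (case t of 0 \<Rightarrow> \<gamma> | Suc s \<Rightarrow> pair_law \<pi> s \<bind> p)"

definition history_law :: "('x, 'a) policy \<Rightarrow> nat \<Rightarrow> (nat \<Rightarrow> 'x \<times> 'a) measure" where
  "history_law \<pi> t = Ionescu_Tulcea.C (step_kernel S \<gamma> p \<pi>) (\<lambda>_. pairs) 0 t (\<lambda>_. undefined)"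

text \<open>Conditional law of \<open>X\<^sub>t\<close> given the past pairs: the first of the two random choices of which
\<open>step_kernel\<close> consists.\<close>
definition next_state :: "nat \<Rightarrow> (nat \<Rightarrow> 'x \<times> 'a) \<Rightarrow> 'x measure" where
  "next_state t \<omega> = (if t = 0 then \<gamma> else p (\<omega> (t - 1)))"

lemma next_state_measurable: "next_state t \<in> (\<Pi>\<^sub>M i\<in>{0..<t}. pairs) \<rightarrow>\<^sub>M prob_algebra S"
proof (cases "t = 0")
  case True
  then show ?thesis using initial unfolding next_state_def[abs_def] by simp
next
  case False
  then have "(\<lambda>\<omega>. p (\<omega> (t - 1))) \<in> (\<Pi>\<^sub>M i\<in>{0..<t}. pairs) \<rightarrow>\<^sub>M prob_algebra S"
    by (intro measurable_compose[OF _ kernel] measurable_component_singleton) auto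
  with False show ?thesis unfolding next_state_def[abs_def] by simp
qed

context
  fixes \<pi> :: "('x, 'a) policy"
  assumes policy: "\<pi> \<in> policies S"
begin

interpretation IT: Ionescu_Tulcea "step_kernel S \<gamma> p \<pi>" "\<lambda>_. pairs"
  using initial kernel policy by (rule Ionescu_Tulcea_step_kernel)

lemma sets_trajectory_law: "sets (trajectory_law S \<gamma> p \<pi>) = sets (\<Pi>\<^sub>M i\<in>UNIV. pairs)"
  unfolding trajectory_law_def by (rule IT.PF.sets_lim)

lemma history_law_prob: "history_law \<pi> t \<in> space (prob_algebra (\<Pi>\<^sub>M i\<in>{0..<t}. pairs))"
  unfolding history_law_def space_prob_algebra
  using IT.prob_space_C[of "\<lambda>_. undefined" 0 t] IT.sets_C[of "\<lambda>_. undefined" 0 t] by simp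

lemma sets_history_law: "sets (history_law \<pi> t) = sets (\<Pi>\<^sub>M i\<in>{0..<t}. pairs)"
  using history_law_prob[of t] by (simp add: space_prob_algebra)

text \<open>The Ionescu-Tulcea limit restricts to the finite-dimensional law on \<open>{0..t}\<close>, whose last coordinate is
the pair at time \<open>t\<close>.\<close>
lemma pair_law_eq_history:
  "pair_law \<pi> t = distr (history_law \<pi> (Suc t)) pairs (\<lambda>\<omega>. \<omega> t)"
proof -
  have upto: "IT.up_to {0..<Suc t} = Suc t"
    using IT.up_to_less[of "{0..<Suc t}" t] by (intro antisym) (auto simp: IT.up_to_iff)
  let ?L = "trajectory_law S \<gamma> p \<pi>" and ?P = "\<Pi>\<^sub>M i\<in>{0..<Suc t}. pairs"
  have comp: "(\<lambda>\<omega>. \<omega> t) \<in> ?P \<rightarrow>\<^sub>M pairs"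
    by (rule measurable_component_singleton) simp
  have restr: "(\<lambda>\<omega>. restrict \<omega> {0..<Suc t}) \<in> ?L \<rightarrow>\<^sub>M ?P"
    unfolding measurable_cong_sets[OF sets_trajectory_law refl]
    by (rule measurable_restrict_subset) simp
  have restr': "(\<lambda>\<omega>. restrict \<omega> {0..<Suc t}) \<in> history_law \<pi> (Suc t) \<rightarrow>\<^sub>M ?P"
    unfolding measurable_cong_sets[OF sets_history_law refl]
    by (rule measurable_restrict_subset) simp
  have "pair_law \<pi> t = distr (distr ?L ?P (\<lambda>\<omega>. restrict \<omega> {0..<Suc t})) pairs (\<lambda>\<omega>. \<omega> t)"
    unfolding pair_law_def
    by (subst distr_distr[OF comp restr]) (auto simp: comp_def intro!: distr_cong)
  also have "distr ?L ?P (\<lambda>\<omega>. restrict \<omega> {0..<Suc t}) = IT.CI {0..<Suc t}"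
    unfolding trajectory_law_def by (rule IT.distr_lim) simp
  also have "\<dots> = distr (history_law \<pi> (Suc t)) ?P (\<lambda>\<omega>. restrict \<omega> {0..<Suc t})"
    unfolding IT.CI_def upto history_law_def ..
  also have "distr \<dots> pairs (\<lambda>\<omega>. \<omega> t) = distr (history_law \<pi> (Suc t)) pairs (\<lambda>\<omega>. \<omega> t)"
    by (subst distr_distr[OF comp restr']) (auto simp: comp_def intro!: distr_cong)
  finally show ?thesis .
qed

lemma pair_law_prob: "pair_law \<pi> t \<in> space (prob_algebra pairs)"
  unfolding pair_law_eq_history
  by (rule distr_in_prob_algebra[OF history_law_prob]) (rule measurable_component_singleton, simp)

lemma step_kernel_eq:
  "step_kernel S \<gamma> p \<pi> t \<omega> = next_state t \<omega> \<bind> (\<lambda>x. \<pi> t (\<omega>, x) \<bind> (\<lambda>a. return pairs (x, a)))"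
  unfolding step_kernel_def next_state_def ..

lemma pair_law_eq_step: "pair_law \<pi> t = history_law \<pi> t \<bind> step_kernel S \<gamma> p \<pi> t"
proof -
  let ?P = "\<lambda>t. \<Pi>\<^sub>M i\<in>{0..<t}. pairs"
  have comp: "(\<lambda>\<omega>. \<omega> t) \<in> ?P (Suc t) \<rightarrow>\<^sub>M pairs"
    by (rule measurable_component_singleton) simp
  have eP: "IT.eP t \<in> ?P t \<rightarrow>\<^sub>M prob_algebra (?P (Suc t))"
    by (rule measurable_prob_algebraI) (auto intro: IT.prob_space_eP)
  have "history_law \<pi> (Suc t) = history_law \<pi> t \<bind> IT.eP t"
    unfolding history_law_def by simp
  then have "pair_law \<pi> t = history_law \<pi> t \<bind> (\<lambda>\<omega>. distr (IT.eP t \<omega>) pairs (\<lambda>\<omega>. \<omega> t))"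
    unfolding pair_law_eq_history
    by (simp add: distr_bind_prob_algebra[OF history_law_prob eP comp])
  also have "\<dots> = history_law \<pi> t \<bind> step_kernel S \<gamma> p \<pi> t"
  proof (rule bind_cong[OF refl])
    fix \<omega> assume "\<omega> \<in> space (history_law \<pi> t)"
    then have \<omega>: "\<omega> \<in> space (?P t)"
      using space_eq_of_prob_algebra[OF history_law_prob] by simp
    have upd: "fun_upd \<omega> t \<in> step_kernel S \<gamma> p \<pi> t \<omega> \<rightarrow>\<^sub>M ?P (Suc t)"
      unfolding measurable_cong_sets[OF IT.sets_P[OF \<omega>] refl]
      by (rule measurable_fun_upd[where J = "{0..<t}"]) (use \<omega> in auto)
    have "distr (IT.eP t \<omega>) pairs (\<lambda>\<omega>. \<omega> t) = distr (step_kernel S \<gamma> p \<pi> t \<omega>) pairs (\<lambda>z. z)"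
      unfolding IT.eP_def by (subst distr_distr[OF comp upd]) (simp add: comp_def)
    then show "distr (IT.eP t \<omega>) pairs (\<lambda>\<omega>. \<omega> t) = step_kernel S \<gamma> p \<pi> t \<omega>"
      by (simp add: distr_id2 IT.sets_P[OF \<omega>])
  qed
  finally show ?thesis .
qed

lemma state_law_eq: "state_law \<pi> t = history_law \<pi> t \<bind> next_state t"
proof (cases t)
  case 0
  have "history_law \<pi> 0 = return (\<Pi>\<^sub>M i\<in>{0..<0}. pairs) (\<lambda>_. undefined)"
    unfolding history_law_def by simp
  then show ?thesis
    using bind_return[OF measurable_prob_algebraD[OF next_state_measurable[of 0]], of "\<lambda>_. undefined"]
    by (simp add: 0 state_law_def next_state_def)
next
  case (Suc s)
  have "state_law \<pi> t = distr (history_law \<pi> (Suc s)) pairs (\<lambda>\<omega>. \<omega> s) \<bind> p"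
    by (simp add: Suc state_law_def pair_law_eq_history)
  also have "\<dots> = history_law \<pi> (Suc s) \<bind> (\<lambda>\<omega>. p (\<omega> s))"
  proof (rule bind_distr[OF _ measurable_prob_algebraD[OF kernel]])
    show "(\<lambda>\<omega>. \<omega> s) \<in> history_law \<pi> (Suc s) \<rightarrow>\<^sub>M pairs"
      unfolding measurable_cong_sets[OF sets_history_law refl]
      by (rule measurable_component_singleton) simp
    show "space (history_law \<pi> (Suc s)) \<noteq> {}"
      using history_law_prob by (auto simp: space_prob_algebra dest: prob_space.not_empty)
  qed
  also have "\<dots> = history_law \<pi> t \<bind> next_state t"
    unfolding Suc next_state_def[abs_def] by simp
  finally show ?thesis .
qed

lemma state_law_prob: "state_law \<pi> t \<in> space (prob_algebra S)"
  unfolding state_law_eq by (rule bind_in_prob_algebra[OF history_law_prob next_state_measurable])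

text \<open>Choosing the action after the state leaves the law of the state alone; hence the state marginal
evolves by \<open>p\<close> whatever the policy remembers.\<close>
lemma distr_fst_pair_law: "distr (pair_law \<pi> t) S fst = state_law \<pi> t"
proof -
  have "distr (pair_law \<pi> t) S fst = history_law \<pi> t \<bind> (\<lambda>\<omega>. distr (step_kernel S \<gamma> p \<pi> t \<omega>) S fst)"
    unfolding pair_law_eq_step
    by (rule distr_bind_prob_algebra[OF history_law_prob step_kernel_measurable[OF initial kernel policy]])
       simp
  also have "\<dots> = history_law \<pi> t \<bind> next_state t"
  proof (rule bind_cong[OF refl])
    fix \<omega> assume "\<omega> \<in> space (history_law \<pi> t)"
    then have \<omega>: "\<omega> \<in> space (\<Pi>\<^sub>M i\<in>{0..<t}. pairs)"
      using space_eq_of_prob_algebra[OF history_law_prob] by simp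
    have pi: "(\<lambda>x. \<pi> t (\<omega>, x)) \<in> S \<rightarrow>\<^sub>M prob_algebra borel"
      using policy
      by (intro measurable_compose[OF measurable_Pair1'[OF \<omega>]]) (simp add: policies_def history_space_def)
    have ret: "(\<lambda>x. \<pi> t (\<omega>, x) \<bind> (\<lambda>a. return pairs (x, a))) \<in> S \<rightarrow>\<^sub>M prob_algebra pairs"
      by (rule measurable_bind_prob_space2[OF pi])
         (auto simp: split_beta' intro!: measurable_compose[OF _ measurable_return_prob_space])
    have ns: "next_state t \<omega> \<in> space (prob_algebra S)"
      using measurable_space[OF next_state_measurable \<omega>] .
    have "distr (step_kernel S \<gamma> p \<pi> t \<omega>) S fst =
        next_state t \<omega> \<bind> (\<lambda>x. distr (\<pi> t (\<omega>, x) \<bind> (\<lambda>a. return pairs (x, a))) S fst)"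
      unfolding step_kernel_eq by (rule distr_bind_prob_algebra[OF ns ret]) simp
    also have "\<dots> = next_state t \<omega> \<bind> return S"
    proof (rule bind_cong[OF refl])
      fix x assume "x \<in> space (next_state t \<omega>)"
      then have x: "x \<in> space S"
        using space_eq_of_prob_algebra[OF ns] by simp
      have pix: "\<pi> t (\<omega>, x) \<in> space (prob_algebra borel)"
        using measurable_space[OF pi x] .
      then interpret \<pi>: prob_space "\<pi> t (\<omega>, x)" by (simp add: space_prob_algebra)
      have "distr (\<pi> t (\<omega>, x) \<bind> (\<lambda>a. return pairs (x, a))) S fst =
          \<pi> t (\<omega>, x) \<bind> (\<lambda>a. distr (return pairs (x, a)) S fst)"
        by (rule distr_bind_prob_algebra[OF pix])
           (use x in \<open>auto intro!: measurable_compose[OF _ measurable_return_prob_space]\<close>)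
      also have "\<dots> = \<pi> t (\<omega>, x) \<bind> (\<lambda>a. return S x)"
        using x pix by (intro bind_cong refl) (auto simp: distr_return space_pair_measure)
      also have "\<dots> = return S x"
        using x by (intro bind_const' \<pi>.prob_space_axioms prob_space_imp_subprob_space prob_space_return)
      finally show "distr (\<pi> t (\<omega>, x) \<bind> (\<lambda>a. return pairs (x, a))) S fst = return S x" .
    qed
    also have "\<dots> = next_state t \<omega>"
      using ns by (intro bind_return'') (simp add: space_prob_algebra)
    finally show "distr (step_kernel S \<gamma> p \<pi> t \<omega>) S fst = next_state t \<omega>" .
  qed
  also have "\<dots> = state_law \<pi> t" by (rule state_law_eq[symmetric])
  finally show ?thesis .
qed

lemma average_cost_eq:
  assumes c: "c \<in> borel_measurable pairs" and bound: "\<And>z. z \<in> space pairs \<Longrightarrow> \<bar>c z\<bar> \<le> B"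
  shows "average_cost S \<gamma> p c \<pi> =
    limsup (\<lambda>T. ereal (1 / real T * (\<Sum>t<T. \<integral>z. c z \<partial>pair_law \<pi> t)))"
proof -
  let ?L = "trajectory_law S \<gamma> p \<pi>"
  have comp: "(\<lambda>\<omega>. \<omega> t) \<in> ?L \<rightarrow>\<^sub>M pairs" for t
    unfolding measurable_cong_sets[OF sets_trajectory_law refl]
    by (rule measurable_component_singleton) simp
  have int: "integrable ?L (\<lambda>\<omega>. c (\<omega> t))" for t
    using integrable_prob_space_bounded[OF pair_law_prob c bound, of t]
    unfolding pair_law_def by (rule integrable_distr[OF comp])
  have "(\<integral>\<omega>. (\<Sum>t<T. c (\<omega> t)) \<partial>?L) = (\<Sum>t<T. \<integral>z. c z \<partial>pair_law \<pi> t)" for T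
    using int by (simp add: pair_law_def integral_distr[OF comp c])
  then show ?thesis
    unfolding average_cost_def by simp
qed

end

text \<open>The history is a pair whose second component is the current state.\<close>
definition stationary :: "('x \<Rightarrow> 'a measure) \<Rightarrow> ('x, 'a) policy" where
  "stationary f t h = f (snd h)"

lemma stationary_policy: "f \<in> S \<rightarrow>\<^sub>M prob_algebra borel \<Longrightarrow> stationary f \<in> policies S"
  unfolding policies_def history_space_def stationary_def[abs_def]
  by (auto intro: measurable_compose[OF measurable_snd])

lemma pair_law_stationary:
  assumes f: "f \<in> S \<rightarrow>\<^sub>M prob_algebra borel"
  shows "pair_law (stationary f) t =
    state_law (stationary f) t \<bind> (\<lambda>x. f x \<bind> (\<lambda>a. return pairs (x, a)))"
proof -
  note policy = stationary_policy[OF f]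
  have ret: "(\<lambda>x. f x \<bind> (\<lambda>a. return pairs (x, a))) \<in> S \<rightarrow>\<^sub>M prob_algebra pairs"
    by (rule measurable_bind_prob_space2[OF f])
       (auto simp: split_beta' intro!: measurable_compose[OF _ measurable_return_prob_space])
  show ?thesis
    unfolding pair_law_eq_step[OF policy] state_law_eq[OF policy]
    by (subst bind_assoc_prob_algebra[OF history_law_prob[OF policy] next_state_measurable ret])
       (auto simp: step_kernel_eq[OF policy] stationary_def intro!: bind_cong)
qed

lemma integral_pair_law_stationary:
  fixes g :: "'x \<times> 'a \<Rightarrow> real"
  assumes f: "f \<in> S \<rightarrow>\<^sub>M prob_algebra borel"
    and g: "g \<in> borel_measurable pairs" and bound: "\<And>z. z \<in> space pairs \<Longrightarrow> \<bar>g z\<bar> \<le> B"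
  shows "(\<integral>z. g z \<partial>pair_law (stationary f) t) = (\<integral>x. (\<integral>a. g (x, a) \<partial>f x) \<partial>state_law (stationary f) t)"
proof -
  have ret: "(\<lambda>x. f x \<bind> (\<lambda>a. return pairs (x, a))) \<in> S \<rightarrow>\<^sub>M prob_algebra pairs"
    by (rule measurable_bind_prob_space2[OF f])
       (auto simp: split_beta' intro!: measurable_compose[OF _ measurable_return_prob_space])
  note law = state_law_prob[OF stationary_policy[OF f], of t]
  have "(\<integral>z. g z \<partial>pair_law (stationary f) t) =
      (\<integral>x. (\<integral>z. g z \<partial>(f x \<bind> (\<lambda>a. return pairs (x, a)))) \<partial>state_law (stationary f) t)"
    unfolding pair_law_stationary[OF f] by (rule integral_bind_prob_algebra[OF law ret g bound])
  also have "\<dots> = (\<integral>x. (\<integral>a. g (x, a) \<partial>f x) \<partial>state_law (stationary f) t)"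
  proof (rule Bochner_Integration.integral_cong[OF refl])
    fix x assume "x \<in> space (state_law (stationary f) t)"
    then have x: "x \<in> space S"
      using space_eq_of_prob_algebra[OF law] by simp
    then have fx: "f x \<in> space (prob_algebra borel)"
      using measurable_space[OF f] by simp
    have "(\<integral>z. g z \<partial>(f x \<bind> (\<lambda>a. return pairs (x, a)))) = (\<integral>a. (\<integral>z. g z \<partial>return pairs (x, a)) \<partial>f x)"
      by (rule integral_bind_prob_algebra[OF fx _ g bound])
         (use x in \<open>auto intro!: measurable_compose[OF _ measurable_return_prob_space]\<close>)
    also have "\<dots> = (\<integral>a. g (x, a) \<partial>f x)"
      using x by (intro Bochner_Integration.integral_cong refl integral_return g)
                 (auto simp: space_pair_measure)
    finally show "(\<integral>z. g z \<partial>(f x \<bind> (\<lambda>a. return pairs (x, a)))) = (\<integral>a. g (x, a) \<partial>f x)" .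
  qed
  finally show ?thesis .
qed

end

section \<open>Measures on finitely many cells and their conditional laws\<close>

lemma integral_uniform_measure:
  fixes f :: "'b \<Rightarrow> real"
  assumes f: "f \<in> borel_measurable M" and A: "A \<in> sets M"
    and pos: "emeasure M A \<noteq> 0" and fin: "emeasure M A \<noteq> \<infinity>"
  shows "(\<integral>x. f x \<partial>uniform_measure M A) = (\<integral>x. indicator A x * f x \<partial>M) / measure M A"
proof -
  have m: "measure M A > 0" and e: "emeasure M A = ennreal (measure M A)"
    using pos fin by (auto simp: measure_def enn2real_positive_iff top.not_eq_extremum zero_less_iff_neq_zero)
  have "uniform_measure M A = density M (\<lambda>x. ennreal (indicator A x / measure M A))"
    unfolding uniform_measure_def e
    by (intro density_cong) (use m A in \<open>auto simp: divide_ennreal ennreal_1[symmetric] simp del: ennreal_1 split: split_indicator\<close>)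
  then have "(\<integral>x. f x \<partial>uniform_measure M A) = (\<integral>x. indicator A x / measure M A * f x \<partial>M)"
    using f A by (simp add: integral_density)
  also have "\<dots> = (\<integral>x. indicator A x * f x / measure M A \<partial>M)"
    by simp
  finally show ?thesis by simp
qed

lemma measure_pmf_bind_in_prob_algebra:
  assumes "\<And>i. K i \<in> space (prob_algebra N)"
  shows "measure_pmf w \<bind> K \<in> space (prob_algebra N)"
  by (rule bind_in_prob_algebra[where L = "count_space UNIV"])
     (use assms in \<open>auto simp: space_prob_algebra measure_pmf.prob_space_axioms\<close>)

lemma integral_measure_pmf_bind:
  fixes f :: "'c \<Rightarrow> real"
  assumes "\<And>i. K i \<in> space (prob_algebra N)"
    and "f \<in> borel_measurable N" and "\<And>x. x \<in> space N \<Longrightarrow> \<bar>f x\<bar> \<le> B"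
  shows "(\<integral>x. f x \<partial>(measure_pmf w \<bind> K)) = (\<integral>i. (\<integral>x. f x \<partial>K i) \<partial>measure_pmf w)"
  by (rule integral_bind_prob_algebra[where L = "count_space UNIV"])
     (use assms in \<open>auto simp: space_prob_algebra measure_pmf.prob_space_axioms\<close>)

text \<open>As \<open>u\<close> has total mass zero, the common part \<open>(1 - \<alpha>) L\<close> of all rows can be subtracted from \<open>P\<close> for free.
What remains is nonnegative with row sums \<open>\<alpha>\<close>.\<close>
lemma Doeblin_contraction:
  fixes u L :: "'y \<Rightarrow> real" and P :: "'y \<Rightarrow> 'y \<Rightarrow> real"
  assumes rows: "\<And>y. y \<in> F \<Longrightarrow> (\<Sum>y'\<in>F. P y y') = 1"
    and minorized: "\<And>y y'. y \<in> F \<Longrightarrow> y' \<in> F \<Longrightarrow> (1 - \<alpha>) * L y' \<le> P y y'"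
    and L: "(\<Sum>y\<in>F. L y) = 1" and u: "(\<Sum>y\<in>F. u y) = 0"
  shows "(\<Sum>y'\<in>F. \<bar>\<Sum>y\<in>F. u y * P y y'\<bar>) \<le> \<alpha> * (\<Sum>y\<in>F. \<bar>u y\<bar>)"
proof -
  have "(\<Sum>y\<in>F. u y * P y y') = (\<Sum>y\<in>F. u y * (P y y' - (1 - \<alpha>) * L y'))" for y'
    using u by (simp add: right_diff_distrib sum_subtractf flip: sum_distrib_right)
  then have "(\<Sum>y'\<in>F. \<bar>\<Sum>y\<in>F. u y * P y y'\<bar>)
      \<le> (\<Sum>y'\<in>F. \<Sum>y\<in>F. \<bar>u y\<bar> * (P y y' - (1 - \<alpha>) * L y'))"
    by (auto intro!: sum_mono order_trans[OF sum_abs] simp: abs_mult minorized)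
  also have "\<dots> = (\<Sum>y\<in>F. \<bar>u y\<bar> * (\<Sum>y'\<in>F. P y y' - (1 - \<alpha>) * L y'))"
    by (subst sum.swap) (simp add: sum_distrib_left)
  also have "\<dots> = (\<Sum>y\<in>F. \<bar>u y\<bar> * \<alpha>)"
    by (intro sum.cong refl) (simp add: sum_subtractf rows L flip: sum_distrib_left)
  finally show ?thesis by (simp add: sum_distrib_left mult.commute)
qed

text \<open>The transition law to which both models are compared. It is given by its point probabilities \<open>r\<close>;
\<open>L\<close> is the image of the minorizing measure on the cells.\<close>
locale reference_chain =
  fixes F :: "'y set" and r :: "'y \<times> 'a::topological_space \<Rightarrow> 'y \<Rightarrow> real"
    and L :: "'y \<Rightarrow> real" and \<alpha> :: real
  assumes finite_F: "finite F"
    and r_measurable: "\<And>y'. y' \<in> F \<Longrightarrow> (\<lambda>z. r z y') \<in> borel_measurable (count_space F \<Otimes>\<^sub>M borel)"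
    and r_sum: "\<And>y a. y \<in> F \<Longrightarrow> (\<Sum>y'\<in>F. r (y, a) y') = 1"
    and r_minorized: "\<And>y y' a. y \<in> F \<Longrightarrow> y' \<in> F \<Longrightarrow> (1 - \<alpha>) * L y' \<le> r (y, a) y'"
    and L_nonneg: "\<And>y. y \<in> F \<Longrightarrow> 0 \<le> L y" and L_sum: "(\<Sum>y\<in>F. L y) = 1"
    and \<alpha>: "0 \<le> \<alpha>" "\<alpha> < 1"
begin

abbreviation cells :: "('y \<times> 'a) measure" where
  "cells \<equiv> count_space F \<Otimes>\<^sub>M borel"

definition mass :: "('y \<times> 'a) measure \<Rightarrow> 'y \<Rightarrow> real" where
  "mass \<mu> y = measure \<mu> ({y} \<times> UNIV)"

text \<open>How far \<open>\<mu>\<close> is from satisfying the balance equation between its cell marginal and the image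
of \<open>\<mu>\<close> under \<open>r\<close>. It is zero exactly for the occupation measures of stationary regimes.\<close>
definition defect :: "('y \<times> 'a) measure \<Rightarrow> real" where
  "defect \<mu> = (\<Sum>y'\<in>F. \<bar>mass \<mu> y' - (\<integral>z. r z y' \<partial>\<mu>)\<bar>)"

text \<open>On cells of mass zero any probability measure would do; the Dirac measure there makes the kernel
total.\<close>
definition conditional :: "('y \<times> 'a) measure \<Rightarrow> 'y \<Rightarrow> 'a measure" where
  "conditional \<mu> y = (if mass \<mu> y = 0 then return borel undefined
     else distr (uniform_measure \<mu> ({y} \<times> UNIV)) borel snd)"

lemma space_cells: "space cells = F \<times> UNIV"
  by (simp add: space_pair_measure)

lemma fiber_sets: "y \<in> F \<Longrightarrow> {y} \<times> UNIV \<in> sets cells"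
  by (intro pair_measureI) auto

lemma r_nonneg: "y \<in> F \<Longrightarrow> y' \<in> F \<Longrightarrow> 0 \<le> r (y, a) y'"
  using \<alpha> by (intro order_trans[OF mult_nonneg_nonneg r_minorized]) (auto simp: L_nonneg)

lemma r_bounded: "y' \<in> F \<Longrightarrow> z \<in> space cells \<Longrightarrow> \<bar>r z y'\<bar> \<le> 1"
proof -
  assume y': "y' \<in> F" and z: "z \<in> space cells"
  then obtain y a where "z = (y, a)" "y \<in> F" by (auto simp: space_cells)
  moreover from this have "r (y, a) y' \<le> (\<Sum>y'\<in>F. r (y, a) y')"
    using y' finite_F by (intro member_le_sum) (auto simp: r_nonneg)
  ultimately show "\<bar>r z y'\<bar> \<le> 1"
    using r_sum[of y a] r_nonneg[of y y' a] y' by simp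
qed

lemma indicator_fst_measurable:
  "(\<lambda>z. indicator {y} (fst z) :: real) \<in> borel_measurable cells"
  by (rule measurable_compose[OF measurable_fst]) simp

text \<open>This form turns statements about marginals of averages and mixtures into statements about
integrals.\<close>
lemma mass_eq_integral:
  assumes \<mu>: "\<mu> \<in> space (prob_algebra cells)"
  shows "mass \<mu> y = (\<integral>z. indicator {y} (fst z) \<partial>\<mu>)"
proof -
  have "(\<integral>z. indicator {y} (fst z) \<partial>\<mu>) = (\<integral>z. indicator ({y} \<times> UNIV) z \<partial>\<mu> :: real)"
    by (intro Bochner_Integration.integral_cong refl) (auto split: split_indicator)
  also have "\<dots> = measure \<mu> ({y} \<times> UNIV \<inter> space \<mu>)" by simp
  also have "\<dots> = mass \<mu> y"
  proof (cases "y \<in> F")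
    case True
    then show ?thesis
      using space_eq_of_prob_algebra[OF \<mu>] unfolding mass_def by (intro arg_cong[where f = "measure \<mu>"]) (auto simp: space_cells)
  next
    case False
    then have "({y} \<times> UNIV) \<inter> space \<mu> = {}"
      using space_eq_of_prob_algebra[OF \<mu>] by (auto simp: space_cells)
    moreover have "{y} \<times> UNIV \<notin> sets \<mu>"
      using False \<mu> sets.sets_into_space[of "{y} \<times> UNIV" cells] by (auto simp: space_prob_algebra space_cells)
    ultimately show ?thesis by (simp add: mass_def measure_notin_sets)
  qed
  finally show ?thesis ..
qed

lemma mass_nonneg: "0 \<le> mass \<mu> y"
  by (simp add: mass_def)

lemma integral_split_fibers:
  assumes \<mu>: "\<mu> \<in> space (prob_algebra cells)"
    and f: "f \<in> borel_measurable cells" and bound: "\<And>z. z \<in> space cells \<Longrightarrow> \<bar>f z\<bar> \<le> (B::real)"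
  shows "(\<integral>z. f z \<partial>\<mu>) = (\<Sum>y\<in>F. \<integral>z. indicator ({y} \<times> UNIV) z * f z \<partial>\<mu>)"
proof -
  have "integrable \<mu> (\<lambda>z. indicator ({y} \<times> UNIV) z * f z)" if "y \<in> F" for y
    using fiber_sets[OF that] bound
    by (intro integrable_prob_space_bounded[OF \<mu>, where B = B] borel_measurable_times f)
       (force split: split_indicator)+
  then have "(\<Sum>y\<in>F. \<integral>z. indicator ({y} \<times> UNIV) z * f z \<partial>\<mu>)
      = (\<integral>z. (\<Sum>y\<in>F. indicator ({y} \<times> UNIV) z * f z) \<partial>\<mu>)"
    by simp
  also have "\<dots> = (\<integral>z. f z \<partial>\<mu>)"
  proof (intro Bochner_Integration.integral_cong refl)
    fix z assume "z \<in> space \<mu>"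
    then have "fst z \<in> F"
      using space_eq_of_prob_algebra[OF \<mu>] by (auto simp: space_cells)
    then have "(\<Sum>y\<in>F. indicator ({y} \<times> UNIV) z :: real) = (\<Sum>y\<in>F. if y = fst z then 1 else 0)"
      by (intro sum.cong refl) (auto simp: mem_Times_iff split: split_indicator)
    then show "(\<Sum>y\<in>F. indicator ({y} \<times> UNIV) z * f z) = f z"
      using \<open>fst z \<in> F\<close> finite_F by (simp flip: sum_distrib_right)
  qed
  finally show ?thesis ..
qed

lemma mass_sum:
  assumes \<mu>: "\<mu> \<in> space (prob_algebra cells)"
  shows "(\<Sum>y\<in>F. mass \<mu> y) = 1"
proof -
  interpret prob_space \<mu> using \<mu> by (simp add: space_prob_algebra)
  have "(1::real) = (\<integral>z. 1 \<partial>\<mu>)" by (simp add: prob_space)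
  also have "\<dots> = (\<Sum>y\<in>F. \<integral>z. indicator ({y} \<times> UNIV) z * 1 \<partial>\<mu>)"
    by (rule integral_split_fibers[OF \<mu>, where B = 1]) auto
  also have "\<dots> = (\<Sum>y\<in>F. mass \<mu> y)"
    unfolding mass_eq_integral[OF \<mu>]
    by (intro sum.cong Bochner_Integration.integral_cong refl) (auto split: split_indicator)
  finally show ?thesis ..
qed

lemma conditional_prob:
  assumes \<mu>: "\<mu> \<in> space (prob_algebra cells)"
  shows "conditional \<mu> y \<in> space (prob_algebra borel)"
proof (cases "mass \<mu> y = 0")
  case True
  then show ?thesis
    by (simp add: conditional_def space_prob_algebra prob_space_return)
next
  case False
  interpret prob_space \<mu> using \<mu> by (simp add: space_prob_algebra)
  have sets: "sets \<mu> = sets cells" using \<mu> by (simp add: space_prob_algebra)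
  have "snd \<in> uniform_measure \<mu> ({y} \<times> UNIV) \<rightarrow>\<^sub>M borel"
    using measurable_cong_sets[of "uniform_measure \<mu> ({y} \<times> UNIV)" cells, OF _ refl] sets
    by (simp add: uniform_measure_def)
  moreover have "prob_space (uniform_measure \<mu> ({y} \<times> UNIV))"
    using False by (intro prob_space_uniform_measure) (auto simp: mass_def emeasure_eq_measure)
  ultimately show ?thesis
    using False by (simp add: conditional_def space_prob_algebra prob_space.prob_space_distr)
qed

lemma disintegration:
  assumes \<mu>: "\<mu> \<in> space (prob_algebra cells)"
    and f: "f \<in> borel_measurable cells" and bound: "\<And>z. z \<in> space cells \<Longrightarrow> \<bar>f z\<bar> \<le> (B::real)"
  shows "(\<integral>z. f z \<partial>\<mu>) = (\<Sum>y\<in>F. mass \<mu> y * (\<integral>a. f (y, a) \<partial>conditional \<mu> y))"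
proof -
  interpret prob_space \<mu> using \<mu> by (simp add: space_prob_algebra)
  have sets: "sets \<mu> = sets cells" using \<mu> by (simp add: space_prob_algebra)
  have "(\<integral>z. indicator ({y} \<times> UNIV) z * f z \<partial>\<mu>) = mass \<mu> y * (\<integral>a. f (y, a) \<partial>conditional \<mu> y)"
    if y: "y \<in> F" for y
  proof (cases "mass \<mu> y = 0")
    case True
    then have "{y} \<times> UNIV \<in> null_sets \<mu>"
      using fiber_sets[OF y] sets by (simp add: null_sets_def mass_def emeasure_eq_measure)
    then have "AE z in \<mu>. indicator ({y} \<times> UNIV) z * f z = 0"
      by (rule AE_I') (auto split: split_indicator)
    then show ?thesis
      using True by (simp add: integral_eq_zero_AE)
  next
    case False
    let ?U = "uniform_measure \<mu> ({y} \<times> UNIV)"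
    have snd: "snd \<in> ?U \<rightarrow>\<^sub>M borel"
      using measurable_cong_sets[of ?U cells, OF _ refl] sets by (simp add: uniform_measure_def)
    have fy: "(\<lambda>a. f (y, a)) \<in> borel_measurable borel"
      using y by (intro measurable_compose[OF measurable_Pair1' f]) simp
    have fy': "(\<lambda>z. f (y, snd z)) \<in> borel_measurable \<mu>"
      unfolding measurable_cong_sets[OF sets refl] by (rule measurable_compose[OF measurable_snd fy])
    have "(\<integral>a. f (y, a) \<partial>conditional \<mu> y) = (\<integral>z. f (y, snd z) \<partial>?U)"
      using False by (simp add: conditional_def integral_distr[OF snd fy])
    also have "\<dots> = (\<integral>z. indicator ({y} \<times> UNIV) z * f (y, snd z) \<partial>\<mu>) / mass \<mu> y"
      unfolding mass_def using False fiber_sets[OF y] sets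
      by (intro integral_uniform_measure fy') (auto simp: mass_def emeasure_eq_measure)
    also have "(\<integral>z. indicator ({y} \<times> UNIV) z * f (y, snd z) \<partial>\<mu>) = (\<integral>z. indicator ({y} \<times> UNIV) z * f z \<partial>\<mu>)"
      by (intro Bochner_Integration.integral_cong refl) (auto split: split_indicator)
    finally show ?thesis using False by simp
  qed
  then show ?thesis
    using integral_split_fibers[OF \<mu> f bound] by simp
qed

lemma conditional_integral_bounds:
  assumes \<mu>: "\<mu> \<in> space (prob_algebra cells)" and y: "y \<in> F"
    and f: "f \<in> borel_measurable cells"
    and bounds: "\<And>z. z \<in> space cells \<Longrightarrow> A \<le> f z \<and> f z \<le> (B::real)"
  shows "A \<le> (\<integral>a. f (y, a) \<partial>conditional \<mu> y) \<and> (\<integral>a. f (y, a) \<partial>conditional \<mu> y) \<le> B"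
proof -
  note cond = conditional_prob[OF \<mu>, of y]
  interpret prob_space "conditional \<mu> y" using cond by (simp add: space_prob_algebra)
  have b: "A \<le> f (y, a) \<and> f (y, a) \<le> B" for a
    using y by (intro bounds) (simp add: space_cells)
  have "integrable (conditional \<mu> y) (\<lambda>a. f (y, a))"
    using b y by (intro integrable_prob_space_bounded[OF cond, where B = "max \<bar>A\<bar> \<bar>B\<bar>"]
      measurable_compose[OF measurable_Pair1' f]) (auto simp: abs_if max_def, (smt (verit))+)
  then show ?thesis
    using integral_mono[of "conditional \<mu> y" "\<lambda>_. A" "\<lambda>a. f (y, a)"]
      integral_mono[of "conditional \<mu> y" "\<lambda>a. f (y, a)" "\<lambda>_. B"] b
    by (simp add: prob_space)
qed

definition transition :: "('y \<times> 'a) measure \<Rightarrow> 'y \<Rightarrow> 'y \<Rightarrow> real" where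
  "transition \<mu> y y' = (\<integral>a. r (y, a) y' \<partial>conditional \<mu> y)"

lemma transition_minorized:
  assumes "\<mu> \<in> space (prob_algebra cells)" and "y \<in> F" and "y' \<in> F"
  shows "(1 - \<alpha>) * L y' \<le> transition \<mu> y y'"
proof -
  have "(1 - \<alpha>) * L y' \<le> r z y' \<and> r z y' \<le> 1" if "z \<in> space cells" for z
    using r_bounded[OF assms(3) that] r_minorized[OF _ assms(3), of "fst z" "snd z"] that
    by (auto simp: space_cells)
  from conditional_integral_bounds[OF assms(1,2) r_measurable[OF assms(3)] this]
  show ?thesis by (simp add: transition_def)
qed

lemma transition_sum:
  assumes \<mu>: "\<mu> \<in> space (prob_algebra cells)" and y: "y \<in> F"
  shows "(\<Sum>y'\<in>F. transition \<mu> y y') = 1"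
proof -
  note cond = conditional_prob[OF \<mu>, of y]
  interpret prob_space "conditional \<mu> y" using cond by (simp add: space_prob_algebra)
  have "integrable (conditional \<mu> y) (\<lambda>a. r (y, a) y')" if "y' \<in> F" for y'
    using y r_bounded[OF that]
    by (intro integrable_prob_space_bounded[OF cond, where B = 1]
        measurable_compose[OF measurable_Pair1' r_measurable[OF that]]) (auto simp: space_cells)
  then have "(\<Sum>y'\<in>F. transition \<mu> y y') = (\<integral>a. (\<Sum>y'\<in>F. r (y, a) y') \<partial>conditional \<mu> y)"
    unfolding transition_def by simp
  then show ?thesis by (simp add: r_sum[OF y] prob_space)
qed

lemma defect_eq:
  assumes \<mu>: "\<mu> \<in> space (prob_algebra cells)"
  shows "defect \<mu> = (\<Sum>y'\<in>F. \<bar>mass \<mu> y' - (\<Sum>y\<in>F. mass \<mu> y * transition \<mu> y y')\<bar>)"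
proof -
  have "(\<integral>z. r z y' \<partial>\<mu>) = (\<Sum>y\<in>F. mass \<mu> y * transition \<mu> y y')" if "y' \<in> F" for y'
    unfolding transition_def by (rule disintegration[OF \<mu> r_measurable[OF that] r_bounded[OF that]])
  then show ?thesis unfolding defect_def by (intro sum.cong refl) simp
qed

text \<open>Integrals are linear under mixing and the defect is convex, so mixing with the occupation measure
of a strictly feasible policy creates slack without destroying approximate invariance.\<close>
lemma mixture:
  assumes \<mu>0: "\<mu>0 \<in> space (prob_algebra cells)" and \<mu>1: "\<mu>1 \<in> space (prob_algebra cells)"
    and \<theta>: "0 \<le> \<theta>" "\<theta> \<le> 1"
  obtains \<mu> where "\<mu> \<in> space (prob_algebra cells)"
    and "defect \<mu> \<le> \<theta> * defect \<mu>0 + (1 - \<theta>) * defect \<mu>1"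
    and "\<And>f B. f \<in> borel_measurable cells \<Longrightarrow> (\<And>z. z \<in> space cells \<Longrightarrow> \<bar>f z\<bar> \<le> (B::real)) \<Longrightarrow>
      (\<integral>z. f z \<partial>\<mu>) = \<theta> * (\<integral>z. f z \<partial>\<mu>0) + (1 - \<theta>) * (\<integral>z. f z \<partial>\<mu>1)"
proof -
  \<comment> \<open>The convex combination is realised as a two-stage experiment that starts with a coin of bias \<open>\<theta>\<close>.\<close>
  define K where "K b = (if b then \<mu>0 else \<mu>1)" for b
  define \<mu> where "\<mu> = measure_pmf (bernoulli_pmf \<theta>) \<bind> K"
  have K: "K b \<in> space (prob_algebra cells)" for b
    using \<mu>0 \<mu>1 by (simp add: K_def)
  have \<mu>: "\<mu> \<in> space (prob_algebra cells)"
    unfolding \<mu>_def by (rule measure_pmf_bind_in_prob_algebra[OF K])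
  have mix: "(\<integral>z. f z \<partial>\<mu>) = \<theta> * (\<integral>z. f z \<partial>\<mu>0) + (1 - \<theta>) * (\<integral>z. f z \<partial>\<mu>1)"
    if "f \<in> borel_measurable cells" "\<And>z. z \<in> space cells \<Longrightarrow> \<bar>f z\<bar> \<le> (B::real)" for f B
    unfolding \<mu>_def integral_measure_pmf_bind[OF K that, simplified]
    using \<theta> by (simp add: K_def mult.commute)
  have "defect \<mu> \<le> (\<Sum>y'\<in>F. \<theta> * \<bar>mass \<mu>0 y' - (\<integral>z. r z y' \<partial>\<mu>0)\<bar> + (1 - \<theta>) * \<bar>mass \<mu>1 y' - (\<integral>z. r z y' \<partial>\<mu>1)\<bar>)"
    unfolding defect_def
  proof (rule sum_mono)
    fix y' assume y': "y' \<in> F"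
    have ind: "(\<integral>z. indicator {y'} (fst z) \<partial>\<mu>) =
        \<theta> * (\<integral>z. indicator {y'} (fst z) \<partial>\<mu>0) + (1 - \<theta>) * (\<integral>z. indicator {y'} (fst z) \<partial>\<mu>1)"
      by (rule mix[where B = 1, OF indicator_fst_measurable]) (auto split: split_indicator)
    have rew: "(\<integral>z. r z y' \<partial>\<mu>) = \<theta> * (\<integral>z. r z y' \<partial>\<mu>0) + (1 - \<theta>) * (\<integral>z. r z y' \<partial>\<mu>1)"
      by (rule mix[OF r_measurable[OF y'] r_bounded[OF y']])
    have "mass \<mu> y' - (\<integral>z. r z y' \<partial>\<mu>) =
      \<theta> * (mass \<mu>0 y' - (\<integral>z. r z y' \<partial>\<mu>0)) + (1 - \<theta>) * (mass \<mu>1 y' - (\<integral>z. r z y' \<partial>\<mu>1))"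
      unfolding mass_eq_integral[OF \<mu>] mass_eq_integral[OF \<mu>0] mass_eq_integral[OF \<mu>1] ind rew
      by (simp add: algebra_simps)
    then show "\<bar>mass \<mu> y' - (\<integral>z. r z y' \<partial>\<mu>)\<bar>
      \<le> \<theta> * \<bar>mass \<mu>0 y' - (\<integral>z. r z y' \<partial>\<mu>0)\<bar> + (1 - \<theta>) * \<bar>mass \<mu>1 y' - (\<integral>z. r z y' \<partial>\<mu>1)\<bar>"
      using \<theta> by (simp add: order_trans[OF abs_triangle_ineq] abs_mult)
  qed
  then have "defect \<mu> \<le> \<theta> * defect \<mu>0 + (1 - \<theta>) * defect \<mu>1"
    by (simp add: defect_def sum.distrib sum_distrib_left)
  with \<mu> mix that show ?thesis by blast
qed

end

section \<open>Translation between policies and occupation measures\<close>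

lemma limsup_average_le:
  fixes s :: "nat \<Rightarrow> real"
  assumes "0 \<le> \<alpha>" "\<alpha> < 1" "0 \<le> K" and s: "\<And>t. s t \<le> B + K * \<alpha> ^ t"
  shows "limsup (\<lambda>T. ereal (1 / real T * (\<Sum>t<T. s t))) \<le> ereal B"
proof -
  have "limsup (\<lambda>T. ereal (1 / real T * (\<Sum>t<T. s t)))
      \<le> limsup (\<lambda>T. ereal (B + K / (1 - \<alpha>) * (1 / real T)))"
  proof (rule Limsup_mono, rule eventually_mono[OF eventually_gt_at_top[of 0]])
    fix T :: nat assume T: "0 < T"
    have "(\<Sum>t<T. s t) \<le> (\<Sum>t<T. B + K * \<alpha> ^ t)"
      by (rule sum_mono) (rule s)
    also have "\<dots> = real T * B + K * ((1 - \<alpha> ^ T) / (1 - \<alpha>))"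
      using assms by (simp add: sum.distrib sum_gp_strict flip: sum_distrib_left)
    also have "\<dots> \<le> real T * B + K * (1 / (1 - \<alpha>))"
      using assms by (intro add_left_mono mult_left_mono divide_right_mono) auto
    finally have "(\<Sum>t<T. s t) \<le> real T * B + K / (1 - \<alpha>)" by simp
    then have "1 / real T * (\<Sum>t<T. s t) \<le> 1 / real T * (real T * B + K / (1 - \<alpha>))"
      by (intro mult_left_mono) auto
    also have "\<dots> = B + K / (1 - \<alpha>) * (1 / real T)"
      using T by (simp add: distrib_left)
    finally show "ereal (1 / real T * (\<Sum>t<T. s t)) \<le> ereal (B + K / (1 - \<alpha>) * (1 / real T))"
      by simp
  qed
  also have "\<dots> = ereal B"
  proof (rule lim_imp_Limsup)
    have "(\<lambda>T. B + K / (1 - \<alpha>) * (1 / real T)) \<longlonglongrightarrow> B + K / (1 - \<alpha>) * 0"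
      by (intro tendsto_intros lim_1_over_n)
    then show "((\<lambda>T. ereal (B + K / (1 - \<alpha>) * (1 / real T))) \<longlongrightarrow> ereal B) sequentially"
      by simp
  qed simp
  finally show ?thesis .
qed

text \<open>A controlled process whose image under \<open>Q\<close> moves like the reference chain up to an error \<open>\<epsilon>\<close>, measured
in the \<open>l\<^sup>1\<close> norm on cells, in every step. The original model satisfies this with the
nearest-point map and the finite model with the identity.\<close>
locale lumped_mdp = mdp S \<gamma> p + reference_chain F r L \<alpha>
  for S :: "'x measure" and \<gamma> :: "'x measure"
    and p :: "'x \<times> 'a::topological_space \<Rightarrow> 'x measure"
    and F :: "'y set" and r :: "'y \<times> 'a \<Rightarrow> 'y \<Rightarrow> real" and L :: "'y \<Rightarrow> real" and \<alpha> :: real +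
  fixes Q :: "'x \<Rightarrow> 'y" and \<epsilon> :: real
  assumes Q: "Q \<in> S \<rightarrow>\<^sub>M count_space F"
    and lumping: "\<And>x a. x \<in> space S \<Longrightarrow>
      (\<Sum>y'\<in>F. \<bar>measure (p (x, a)) (Q -` {y'} \<inter> space S) - r (Q x, a) y'\<bar>) \<le> \<epsilon>"
begin

abbreviation lump :: "'x \<times> 'a \<Rightarrow> 'y \<times> 'a" where
  "lump z \<equiv> (Q (fst z), snd z)"

definition cell_law :: "('x, 'a) policy \<Rightarrow> nat \<Rightarrow> 'y \<Rightarrow> real" where
  "cell_law \<pi> t y = measure (state_law \<pi> t) (Q -` {y} \<inter> space S)"

lemma lump_measurable: "lump \<in> pairs \<rightarrow>\<^sub>M cells"
  by (intro measurable_Pair measurable_compose[OF measurable_fst Q] measurable_snd)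

lemma lump_space: "z \<in> space pairs \<Longrightarrow> lump z \<in> space cells"
  using measurable_space[OF lump_measurable] .

lemma cell_sets: "Q -` {y} \<inter> space S \<in> sets S"
proof (cases "y \<in> F")
  case True
  then show ?thesis using measurable_sets[OF Q, of "{y}"] by simp
next
  case False
  then have "Q -` {y} \<inter> space S = {}" using measurable_space[OF Q] by auto
  then show ?thesis by simp
qed

lemma integral_lumped_state:
  fixes h :: "'y \<Rightarrow> real"
  assumes M: "M \<in> space (prob_algebra S)"
  shows "(\<integral>x. h (Q x) \<partial>M) = (\<Sum>y\<in>F. measure M (Q -` {y} \<inter> space S) * h y)"
proof -
  interpret prob_space M using M by (simp add: space_prob_algebra)
  note sp = space_eq_of_prob_algebra[OF M]
  have sets: "Q -` {y} \<inter> space S \<in> sets M" for y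
    using M cell_sets by (simp add: space_prob_algebra)
  have "(\<integral>x. h (Q x) \<partial>M) = (\<integral>x. (\<Sum>y\<in>F. indicator (Q -` {y} \<inter> space S) x * h y) \<partial>M)"
  proof (intro Bochner_Integration.integral_cong refl)
    fix x assume x: "x \<in> space M"
    then have "Q x \<in> F" using measurable_space[OF Q] by (auto simp: sp)
    have "(\<Sum>y\<in>F. indicator (Q -` {y} \<inter> space S) x * h y) = (\<Sum>y\<in>F. if y = Q x then h y else 0)"
      using x by (intro sum.cong refl) (auto simp: sp split: split_indicator)
    then show "h (Q x) = (\<Sum>y\<in>F. indicator (Q -` {y} \<inter> space S) x * h y)"
      using \<open>Q x \<in> F\<close> finite_F by simp
  qed
  also have "\<dots> = (\<Sum>y\<in>F. (\<integral>x. indicator (Q -` {y} \<inter> space S) x * h y \<partial>M))"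
    using sets by (intro Bochner_Integration.integral_sum integrable_mult_left integrable_real_indicator)
                  (auto simp: emeasure_eq_measure)
  also have "\<dots> = (\<Sum>y\<in>F. measure M (Q -` {y} \<inter> space S) * h y)"
    using sets by (intro sum.cong refl) (auto simp: sp[symmetric] Int_absorb2 sets.sets_into_space)
  finally show ?thesis .
qed

lemma cell_measure_sum:
  assumes M: "M \<in> space (prob_algebra S)"
  shows "(\<Sum>y\<in>F. measure M (Q -` {y} \<inter> space S)) = 1"
  using integral_lumped_state[OF M, of "\<lambda>_. 1"] M
  by (simp add: space_prob_algebra prob_space.prob_space)

context
  fixes \<pi> :: "('x, 'a) policy"
  assumes policy: "\<pi> \<in> policies S"
begin

lemma cell_law_sum: "(\<Sum>y\<in>F. cell_law \<pi> t y) = 1"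
  unfolding cell_law_def by (rule cell_measure_sum[OF state_law_prob[OF policy]])

lemma cell_law_nonneg: "0 \<le> cell_law \<pi> t y"
  by (simp add: cell_law_def)

lemma measurable_pair_law: "f \<in> pairs \<rightarrow>\<^sub>M N \<Longrightarrow> f \<in> pair_law \<pi> t \<rightarrow>\<^sub>M N"
  using pair_law_prob[OF policy, of t] measurable_cong_sets[of "pair_law \<pi> t" pairs N N, OF _ refl]
  by (simp add: space_prob_algebra)

lemma cell_law_eq_integral:
  "cell_law \<pi> t y = (\<integral>z. indicator {y} (fst (lump z)) \<partial>pair_law \<pi> t)"
proof -
  have fst: "fst \<in> pair_law \<pi> t \<rightarrow>\<^sub>M S" by (rule measurable_pair_law) simp
  have "((\<integral>x. indicator (Q -` {y} \<inter> space S) x \<partial>state_law \<pi> t) :: real) =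
      (\<integral>z. indicator (Q -` {y} \<inter> space S) (fst z) \<partial>pair_law \<pi> t)"
    unfolding distr_fst_pair_law[OF policy, symmetric]
    by (rule integral_distr[OF fst borel_measurable_indicator[OF cell_sets]])
  also have "\<dots> = (\<integral>z. indicator {y} (fst (lump z)) \<partial>pair_law \<pi> t)"
    using space_eq_of_prob_algebra[OF pair_law_prob[OF policy, of t]]
    by (intro Bochner_Integration.integral_cong refl)
       (auto simp: space_pair_measure split: split_indicator)
  finally show ?thesis
    using space_eq_of_prob_algebra[OF state_law_prob[OF policy, of t]]
    by (simp add: cell_law_def)
qed

text \<open>The bridge from the laws of pairs to a recursion for the laws of cells.\<close>
lemma cell_law_Suc:
  "cell_law \<pi> (Suc t) y = (\<integral>z. measure (p z) (Q -` {y} \<inter> space S) \<partial>pair_law \<pi> t)"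
proof -
  let ?A = "Q -` {y} \<inter> space S"
  have "((\<integral>x. indicator ?A x \<partial>state_law \<pi> (Suc t)) :: real) = (\<integral>z. (\<integral>x. indicator ?A x \<partial>p z) \<partial>pair_law \<pi> t)"
    unfolding state_law_def nat.case
    by (rule integral_bind_prob_algebra[OF pair_law_prob[OF policy] kernel
          borel_measurable_indicator[OF cell_sets], where B = 1])
       (auto split: split_indicator)
  also have "\<dots> = (\<integral>z. measure (p z) ?A \<partial>pair_law \<pi> t)"
  proof (intro Bochner_Integration.integral_cong refl)
    fix z assume "z \<in> space (pair_law \<pi> t)"
    then have "p z \<in> space (prob_algebra S)"
      using measurable_space[OF kernel] space_eq_of_prob_algebra[OF pair_law_prob[OF policy]] by simp
    then have "space (p z) = space S" by (rule space_eq_of_prob_algebra)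
    then show "(\<integral>x. indicator ?A x \<partial>p z) = measure (p z) ?A" by simp
  qed
  finally show ?thesis
    using space_eq_of_prob_algebra[OF state_law_prob[OF policy, of "Suc t"]]
    by (simp add: cell_law_def)
qed

lemma r_lump_measurable: "y' \<in> F \<Longrightarrow> (\<lambda>z. r (lump z) y') \<in> borel_measurable pairs"
  by (rule measurable_compose[OF lump_measurable r_measurable])

lemma r_lump_integrable: "y' \<in> F \<Longrightarrow> integrable (pair_law \<pi> t) (\<lambda>z. r (lump z) y')"
  by (rule integrable_prob_space_bounded[OF pair_law_prob[OF policy] r_lump_measurable, where B = 1])
     (use r_bounded lump_space in auto)

lemma one_step_lumping_error:
  "(\<Sum>y'\<in>F. \<bar>cell_law \<pi> (Suc t) y' - (\<integral>z. r (lump z) y' \<partial>pair_law \<pi> t)\<bar>) \<le> \<epsilon>"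
proof -
  let ?M = "pair_law \<pi> t" and ?m = "\<lambda>z y. measure (p z) (Q -` {y} \<inter> space S)"
  note law = pair_law_prob[OF policy, of t]
  interpret prob_space ?M using law by (simp add: space_prob_algebra)
  have pz: "p z \<in> space (prob_algebra S)" if "z \<in> space pairs" for z
    using measurable_space[OF kernel that] .
  have m_meas: "(\<lambda>z. ?m z y) \<in> borel_measurable pairs" for y
    by (rule measurable_compose[OF kernel measurable_measure_prob_algebra[OF cell_sets]])
  have m_int: "integrable ?M (\<lambda>z. ?m z y)" for y
    by (rule integrable_prob_space_bounded[OF law m_meas, where B = 1])
       (use pz in \<open>auto simp: space_prob_algebra prob_space.prob_le_1\<close>)
  have "(\<Sum>y'\<in>F. \<bar>cell_law \<pi> (Suc t) y' - (\<integral>z. r (lump z) y' \<partial>?M)\<bar>)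
      = (\<Sum>y'\<in>F. \<bar>\<integral>z. ?m z y' - r (lump z) y' \<partial>?M\<bar>)"
    by (intro sum.cong refl arg_cong[where f = abs])
       (simp add: cell_law_Suc Bochner_Integration.integral_diff[OF m_int r_lump_integrable])
  also have "\<dots> \<le> (\<Sum>y'\<in>F. \<integral>z. \<bar>?m z y' - r (lump z) y'\<bar> \<partial>?M)"
    by (intro sum_mono integral_abs_bound)
  also have "\<dots> = (\<integral>z. (\<Sum>y'\<in>F. \<bar>?m z y' - r (lump z) y'\<bar>) \<partial>?M)"
    by (intro Bochner_Integration.integral_sum[symmetric] integrable_abs
        Bochner_Integration.integrable_diff m_int r_lump_integrable)
  also have "\<dots> \<le> (\<integral>z. \<epsilon> \<partial>?M)"
  proof (rule integral_mono)
    show "integrable ?M (\<lambda>z. \<Sum>y'\<in>F. \<bar>?m z y' - r (lump z) y'\<bar>)"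
      by (intro Bochner_Integration.integrable_sum integrable_abs
          Bochner_Integration.integrable_diff m_int r_lump_integrable)
    fix z assume "z \<in> space ?M"
    then have "fst z \<in> space S"
      using space_eq_of_prob_algebra[OF law] by (auto simp: space_pair_measure)
    then show "(\<Sum>y'\<in>F. \<bar>?m z y' - r (lump z) y'\<bar>) \<le> \<epsilon>"
      using lumping[of "fst z" "snd z"] by simp
  qed simp
  finally show ?thesis by (simp add: prob_space)
qed

text \<open>The mass of a cell is the average of its probabilities at times \<open>0, ..., T - 1\<close>. One step
later, up to \<open>\<epsilon>\<close>, it is the average at times \<open>1, ..., T\<close>. Only the two end terms
survive in the difference, and each of them has total mass one, whence \<open>2 / T\<close>.\<close>
lemma occupation_measure:
  assumes T: "0 < T"
  obtains \<mu> where "\<mu> \<in> space (prob_algebra cells)" and "defect \<mu> \<le> 2 / real T + \<epsilon>"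
    and "\<And>f B. f \<in> borel_measurable cells \<Longrightarrow> (\<And>z. z \<in> space cells \<Longrightarrow> \<bar>f z\<bar> \<le> (B::real)) \<Longrightarrow>
      (\<integral>z. f z \<partial>\<mu>) = 1 / real T * (\<Sum>t<T. \<integral>z. f (lump z) \<partial>pair_law \<pi> t)"
proof -
  \<comment> \<open>The average over time is the law of the pair at a uniformly chosen time.\<close>
  define K where "K t = distr (pair_law \<pi> t) cells lump" for t
  define \<mu> where "\<mu> = measure_pmf (pmf_of_set {..<T}) \<bind> K"
  have K: "K t \<in> space (prob_algebra cells)" for t
    unfolding K_def by (rule distr_in_prob_algebra[OF pair_law_prob[OF policy] lump_measurable])
  have \<mu>: "\<mu> \<in> space (prob_algebra cells)"
    unfolding \<mu>_def by (rule measure_pmf_bind_in_prob_algebra[OF K])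
  have int: "(\<integral>z. f z \<partial>\<mu>) = 1 / real T * (\<Sum>t<T. \<integral>z. f (lump z) \<partial>pair_law \<pi> t)"
    if f: "f \<in> borel_measurable cells" and b: "\<And>z. z \<in> space cells \<Longrightarrow> \<bar>f z\<bar> \<le> (B::real)" for f B
  proof -
    have "(\<integral>z. f z \<partial>\<mu>) = (\<integral>t. (\<integral>z. f z \<partial>K t) \<partial>measure_pmf (pmf_of_set {..<T}))"
      unfolding \<mu>_def by (rule integral_measure_pmf_bind[OF K f b])
    also have "\<dots> = (\<Sum>t<T. \<integral>z. f z \<partial>K t) / real T"
      using T by (subst integral_pmf_of_set) auto
    also have "(\<Sum>t<T. \<integral>z. f z \<partial>K t) = (\<Sum>t<T. \<integral>z. f (lump z) \<partial>pair_law \<pi> t)"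
      unfolding K_def by (intro sum.cong refl integral_distr[OF measurable_pair_law[OF lump_measurable] f])
    finally show ?thesis by simp
  qed
  let ?R = "\<lambda>t y'. \<integral>z. r (lump z) y' \<partial>pair_law \<pi> t"
  have "defect \<mu> \<le> (\<Sum>y'\<in>F. 1 / real T * (cell_law \<pi> 0 y' + cell_law \<pi> T y'
      + (\<Sum>t<T. \<bar>cell_law \<pi> (Suc t) y' - ?R t y'\<bar>)))"
    unfolding defect_def
  proof (rule sum_mono)
    fix y' assume y': "y' \<in> F"
    have "mass \<mu> y' = 1 / real T * (\<Sum>t<T. cell_law \<pi> t y')"
      unfolding mass_eq_integral[OF \<mu>] cell_law_eq_integral
      by (rule int[where B = 1, OF indicator_fst_measurable]) (auto split: split_indicator)
    moreover have "(\<integral>z. r z y' \<partial>\<mu>) = 1 / real T * (\<Sum>t<T. ?R t y')"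
      by (rule int[OF r_measurable[OF y'] r_bounded[OF y']])
    ultimately have "mass \<mu> y' - (\<integral>z. r z y' \<partial>\<mu>) =
        1 / real T * ((\<Sum>t<T. cell_law \<pi> t y') - (\<Sum>t<T. ?R t y'))"
      by (simp add: right_diff_distrib)
    also have "(\<Sum>t<T. cell_law \<pi> t y') - (\<Sum>t<T. ?R t y') =
        (cell_law \<pi> 0 y' - cell_law \<pi> T y') + (\<Sum>t<T. cell_law \<pi> (Suc t) y' - ?R t y')"
      using sum_lessThan_telescope[of "\<lambda>t. cell_law \<pi> t y'" T] by (simp add: sum_subtractf)
    finally have "\<bar>mass \<mu> y' - (\<integral>z. r z y' \<partial>\<mu>)\<bar> =
        1 / real T * \<bar>(cell_law \<pi> 0 y' - cell_law \<pi> T y') + (\<Sum>t<T. cell_law \<pi> (Suc t) y' - ?R t y')\<bar>"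
      by (simp add: abs_mult)
    also have "\<dots> \<le> 1 / real T * (cell_law \<pi> 0 y' + cell_law \<pi> T y'
      + (\<Sum>t<T. \<bar>cell_law \<pi> (Suc t) y' - ?R t y'\<bar>))"
      using sum_abs[of "\<lambda>t. cell_law \<pi> (Suc t) y' - ?R t y'" "{..<T}"]
        cell_law_nonneg[of 0 y'] cell_law_nonneg[of T y']
      by (intro mult_left_mono) (auto simp: abs_le_iff)
    finally show "\<bar>mass \<mu> y' - (\<integral>z. r z y' \<partial>\<mu>)\<bar> \<le> 1 / real T * (cell_law \<pi> 0 y' + cell_law \<pi> T y'
      + (\<Sum>t<T. \<bar>cell_law \<pi> (Suc t) y' - ?R t y'\<bar>))" .
  qed
  also have "\<dots> = 1 / real T * (2 + (\<Sum>t<T. \<Sum>y'\<in>F. \<bar>cell_law \<pi> (Suc t) y' - ?R t y'\<bar>))"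
    unfolding sum_distrib_left[symmetric] sum.distrib cell_law_sum by (subst sum.swap) simp
  also have "\<dots> \<le> 1 / real T * (2 + (\<Sum>t<T. \<epsilon>))"
    by (intro mult_left_mono add_left_mono sum_mono one_step_lumping_error) simp
  also have "\<dots> = 2 / real T + \<epsilon>"
    using T by (simp add: field_simps)
  finally have "defect \<mu> \<le> 2 / real T + \<epsilon>" .
  with \<mu> int that show ?thesis by blast
qed

end

text \<open>This is how a measure on cells acts in a model with a larger state space: the action is drawn
from the conditional law of the cell that contains the state.\<close>
definition lumped_policy :: "('y \<times> 'a) measure \<Rightarrow> ('x, 'a) policy" where
  "lumped_policy \<mu> = stationary (\<lambda>x. conditional \<mu> (Q x))"

context
  fixes \<mu> :: "('y \<times> 'a) measure"
  assumes \<mu>: "\<mu> \<in> space (prob_algebra cells)"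
begin

lemma lumped_decision_measurable: "(\<lambda>x. conditional \<mu> (Q x)) \<in> S \<rightarrow>\<^sub>M prob_algebra borel"
  by (rule measurable_compose[OF Q]) (use conditional_prob[OF \<mu>] in auto)

lemma lumped_policy_in_policies: "lumped_policy \<mu> \<in> policies S"
  unfolding lumped_policy_def by (rule stationary_policy[OF lumped_decision_measurable])

lemma integral_lumped_policy:
  fixes g :: "'y \<times> 'a \<Rightarrow> real"
  assumes g: "g \<in> borel_measurable cells" and b: "\<And>z. z \<in> space cells \<Longrightarrow> \<bar>g z\<bar> \<le> B"
  shows "(\<integral>z. g (lump z) \<partial>pair_law (lumped_policy \<mu>) t) =
    (\<Sum>y\<in>F. cell_law (lumped_policy \<mu>) t y * (\<integral>a. g (y, a) \<partial>conditional \<mu> y))"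
proof -
  have "(\<integral>z. g (lump z) \<partial>pair_law (lumped_policy \<mu>) t) =
      (\<integral>x. (\<integral>a. g (lump (x, a)) \<partial>conditional \<mu> (Q x)) \<partial>state_law (lumped_policy \<mu>) t)"
    unfolding lumped_policy_def
    by (rule integral_pair_law_stationary[OF lumped_decision_measurable
          measurable_compose[OF lump_measurable g] b[OF lump_space]])
  also have "\<dots> = (\<integral>x. (\<lambda>y. \<integral>a. g (y, a) \<partial>conditional \<mu> y) (Q x) \<partial>state_law (lumped_policy \<mu>) t)"
    by simp
  also have "\<dots> = (\<Sum>y\<in>F. cell_law (lumped_policy \<mu>) t y * (\<integral>a. g (y, a) \<partial>conditional \<mu> y))"
    unfolding cell_law_def by (rule integral_lumped_state[OF state_law_prob[OF lumped_policy_in_policies]])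
  finally show ?thesis .
qed

text \<open>The distance \<open>D\<^sub>t\<close> satisfies \<open>D\<^sub>t\<^sub>+\<^sub>1 \<le> \<alpha> D\<^sub>t + \<epsilon> + defect\<close>: one step
contracts the difference, the lumping costs \<open>\<epsilon>\<close>, and replacing \<open>mass\<close> by its image costs
the defect.\<close>
lemma distance_to_mass:
  "(\<Sum>y\<in>F. \<bar>cell_law (lumped_policy \<mu>) t y - mass \<mu> y\<bar>) \<le> 2 * \<alpha> ^ t + (\<epsilon> + defect \<mu>) / (1 - \<alpha>)"
proof (induction t)
  let ?l = "cell_law (lumped_policy \<mu>)" and ?\<pi> = "lumped_policy \<mu>"
  note pol = lumped_policy_in_policies
  case 0
  have "0 \<le> (\<Sum>y'\<in>F. \<bar>cell_law ?\<pi> (Suc 0) y' - (\<integral>z. r (lump z) y' \<partial>pair_law ?\<pi> 0)\<bar>)"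
    by (simp add: sum_nonneg)
  then have "0 \<le> \<epsilon>" using one_step_lumping_error[OF pol, of 0] by linarith
  moreover have "0 \<le> defect \<mu>" by (simp add: defect_def sum_nonneg)
  ultimately have "0 \<le> (\<epsilon> + defect \<mu>) / (1 - \<alpha>)" using \<alpha> by simp
  moreover have "(\<Sum>y\<in>F. \<bar>?l 0 y - mass \<mu> y\<bar>) \<le> (\<Sum>y\<in>F. ?l 0 y + mass \<mu> y)"
    using cell_law_nonneg[OF pol] mass_nonneg by (intro sum_mono) (smt (verit))
  moreover have "(\<Sum>y\<in>F. ?l 0 y + mass \<mu> y) = 2"
    by (simp add: sum.distrib cell_law_sum[OF pol] mass_sum[OF \<mu>])
  ultimately show ?case by simp
next
  let ?l = "cell_law (lumped_policy \<mu>)" and ?\<pi> = "lumped_policy \<mu>"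
  note pol = lumped_policy_in_policies
  case (Suc t)
  have R: "(\<integral>z. r (lump z) y' \<partial>pair_law ?\<pi> t) = (\<Sum>y\<in>F. ?l t y * transition \<mu> y y')" if "y' \<in> F" for y'
    unfolding transition_def by (rule integral_lumped_policy[OF r_measurable[OF that] r_bounded[OF that]])
  have "(\<Sum>y'\<in>F. \<bar>?l (Suc t) y' - mass \<mu> y'\<bar>)
      \<le> (\<Sum>y'\<in>F. \<bar>?l (Suc t) y' - (\<integral>z. r (lump z) y' \<partial>pair_law ?\<pi> t)\<bar>
        + \<bar>\<Sum>y\<in>F. (?l t y - mass \<mu> y) * transition \<mu> y y'\<bar>
        + \<bar>mass \<mu> y' - (\<Sum>y\<in>F. mass \<mu> y * transition \<mu> y y')\<bar>)"
  proof (rule sum_mono)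
    fix y' assume "y' \<in> F"
    then have "(\<Sum>y\<in>F. (?l t y - mass \<mu> y) * transition \<mu> y y') =
        (\<integral>z. r (lump z) y' \<partial>pair_law ?\<pi> t) - (\<Sum>y\<in>F. mass \<mu> y * transition \<mu> y y')"
      by (simp add: R left_diff_distrib sum_subtractf)
    then show "\<bar>?l (Suc t) y' - mass \<mu> y'\<bar>
      \<le> \<bar>?l (Suc t) y' - (\<integral>z. r (lump z) y' \<partial>pair_law ?\<pi> t)\<bar>
        + \<bar>\<Sum>y\<in>F. (?l t y - mass \<mu> y) * transition \<mu> y y'\<bar>
        + \<bar>mass \<mu> y' - (\<Sum>y\<in>F. mass \<mu> y * transition \<mu> y y')\<bar>"
      by linarith
  qed
  also have "\<dots> = (\<Sum>y'\<in>F. \<bar>?l (Suc t) y' - (\<integral>z. r (lump z) y' \<partial>pair_law ?\<pi> t)\<bar>)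
        + (\<Sum>y'\<in>F. \<bar>\<Sum>y\<in>F. (?l t y - mass \<mu> y) * transition \<mu> y y'\<bar>) + defect \<mu>"
    by (simp add: sum.distrib defect_eq[OF \<mu>])
  also have "\<dots> \<le> \<epsilon> + \<alpha> * (\<Sum>y\<in>F. \<bar>?l t y - mass \<mu> y\<bar>) + defect \<mu>"
    using one_step_lumping_error[OF pol]
    by (intro add_mono Doeblin_contraction[where L = L] order_refl)
       (auto simp: transition_sum[OF \<mu>] transition_minorized[OF \<mu>] L_sum sum_subtractf
          cell_law_sum[OF pol] mass_sum[OF \<mu>])
  also have "\<dots> \<le> \<epsilon> + \<alpha> * (2 * \<alpha> ^ t + (\<epsilon> + defect \<mu>) / (1 - \<alpha>)) + defect \<mu>"
    using \<alpha> by (intro add_mono mult_left_mono Suc.IH) auto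
  also have "\<dots> = 2 * \<alpha> ^ Suc t + (\<epsilon> + defect \<mu>) / (1 - \<alpha>)"
    using \<alpha> by (simp add: field_simps)
  finally show ?case .
qed

text \<open>The distance of the cell law to \<open>mass \<mu>\<close>, multiplied by the bound \<open>C\<close> of the cost, controls the
error of the expected cost at each time; the geometric part of it disappears in the time average.\<close>
lemma average_cost_lumped_policy:
  assumes c: "c \<in> borel_measurable pairs" and g: "g \<in> borel_measurable cells"
    and close: "\<And>z. z \<in> space pairs \<Longrightarrow> \<bar>c z - g (lump z)\<bar> \<le> \<epsilon>"
    and g_bounds: "\<And>z. z \<in> space cells \<Longrightarrow> 0 \<le> g z \<and> g z \<le> C" and "0 \<le> C"
  shows "average_cost S \<gamma> p c (lumped_policy \<mu>)
    \<le> ereal ((\<integral>z. g z \<partial>\<mu>) + \<epsilon> + C * ((\<epsilon> + defect \<mu>) / (1 - \<alpha>)))"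
proof -
  let ?\<pi> = "lumped_policy \<mu>" and ?l = "cell_law (lumped_policy \<mu>)"
  let ?G = "\<lambda>y. \<integral>a. g (y, a) \<partial>conditional \<mu> y"
  note pol = lumped_policy_in_policies
  have g_abs: "\<bar>g z\<bar> \<le> C" if "z \<in> space cells" for z
    using g_bounds[OF that] by simp
  have c_abs: "\<bar>c z\<bar> \<le> C + \<epsilon>" if "z \<in> space pairs" for z
    using close[OF that] g_abs[OF lump_space[OF that]] by linarith
  have step: "(\<integral>z. c z \<partial>pair_law ?\<pi> t) \<le>
      ((\<integral>z. g z \<partial>\<mu>) + \<epsilon> + C * ((\<epsilon> + defect \<mu>) / (1 - \<alpha>))) + 2 * C * \<alpha> ^ t" for t
  proof -
    note law = pair_law_prob[OF pol, of t]
    interpret prob_space "pair_law ?\<pi> t" using law by (simp add: space_prob_algebra)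
    have gl: "integrable (pair_law ?\<pi> t) (\<lambda>z. g (lump z))"
      by (rule integrable_prob_space_bounded[OF law measurable_compose[OF lump_measurable g] g_abs[OF lump_space]])
    have cl: "integrable (pair_law ?\<pi> t) c"
      by (rule integrable_prob_space_bounded[OF law c c_abs])
    have "(\<integral>z. c z \<partial>pair_law ?\<pi> t) \<le> (\<integral>z. g (lump z) + \<epsilon> \<partial>pair_law ?\<pi> t)"
    proof (rule integral_mono[OF cl])
      fix z assume "z \<in> space (pair_law ?\<pi> t)"
      then show "c z \<le> g (lump z) + \<epsilon>"
        using close[of z] space_eq_of_prob_algebra[OF law] by auto
    qed (use gl in simp)
    also have "\<dots> = (\<Sum>y\<in>F. ?l t y * ?G y) + \<epsilon>"
      using gl by (simp add: prob_space integral_lumped_policy[OF g g_abs])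
    also have "(\<Sum>y\<in>F. ?l t y * ?G y) = (\<Sum>y\<in>F. mass \<mu> y * ?G y) + (\<Sum>y\<in>F. (?l t y - mass \<mu> y) * ?G y)"
      by (simp add: left_diff_distrib sum_subtractf)
    also have "(\<Sum>y\<in>F. mass \<mu> y * ?G y) = (\<integral>z. g z \<partial>\<mu>)"
      by (rule disintegration[OF \<mu> g g_abs, symmetric])
    also have "(\<Sum>y\<in>F. (?l t y - mass \<mu> y) * ?G y) \<le> (\<Sum>y\<in>F. \<bar>?l t y - mass \<mu> y\<bar> * C)"
    proof (rule sum_mono)
      fix y assume "y \<in> F"
      then have "0 \<le> ?G y \<and> ?G y \<le> C"
        by (rule conditional_integral_bounds[OF \<mu> _ g g_bounds])
      then show "(?l t y - mass \<mu> y) * ?G y \<le> \<bar>?l t y - mass \<mu> y\<bar> * C"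
        by (intro mult_mono) auto
    qed
    also have "\<dots> \<le> (2 * \<alpha> ^ t + (\<epsilon> + defect \<mu>) / (1 - \<alpha>)) * C"
      unfolding sum_distrib_right[symmetric] using \<open>0 \<le> C\<close> by (intro mult_right_mono distance_to_mass)
    finally show ?thesis by (simp add: algebra_simps)
  qed
  have "average_cost S \<gamma> p c ?\<pi> = limsup (\<lambda>T. ereal (1 / real T * (\<Sum>t<T. \<integral>z. c z \<partial>pair_law ?\<pi> t)))"
    by (rule average_cost_eq[OF pol c c_abs])
  also have "\<dots> \<le> ereal ((\<integral>z. g z \<partial>\<mu>) + \<epsilon> + C * ((\<epsilon> + defect \<mu>) / (1 - \<alpha>)))"
    by (rule limsup_average_le[OF \<alpha> _ step]) (use \<open>0 \<le> C\<close> in simp)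
  finally show ?thesis .
qed

end

text \<open>An upper limit of at most \<open>v i\<close> keeps the averages eventually below \<open>v i + \<eta>\<close>, and as \<open>I\<close> is finite,
one horizon \<open>T\<close> serves all costs at once.\<close>
lemma occupation_of_policy:
  fixes c :: "'i \<Rightarrow> 'x \<times> 'a \<Rightarrow> real" and g :: "'i \<Rightarrow> 'y \<times> 'a \<Rightarrow> real"
  assumes policy: "\<pi> \<in> policies S" and "finite I" and \<eta>: "0 < \<eta>"
    and c: "\<And>i. i \<in> I \<Longrightarrow> c i \<in> borel_measurable pairs"
    and g: "\<And>i. i \<in> I \<Longrightarrow> g i \<in> borel_measurable cells"
    and close: "\<And>i z. i \<in> I \<Longrightarrow> z \<in> space pairs \<Longrightarrow> \<bar>c i z - g i (lump z)\<bar> \<le> \<epsilon>"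
    and g_bounds: "\<And>i z. i \<in> I \<Longrightarrow> z \<in> space cells \<Longrightarrow> 0 \<le> g i z \<and> g i z \<le> C"
    and cost: "\<And>i. i \<in> I \<Longrightarrow> average_cost S \<gamma> p (c i) \<pi> \<le> ereal (v i)"
  obtains \<mu> where "\<mu> \<in> space (prob_algebra cells)" and "defect \<mu> \<le> \<eta> + \<epsilon>"
    and "\<And>i. i \<in> I \<Longrightarrow> (\<integral>z. g i z \<partial>\<mu>) \<le> v i + \<eta> + \<epsilon>"
proof -
  have g_abs: "\<bar>g i z\<bar> \<le> C" if "i \<in> I" "z \<in> space cells" for i z
    using g_bounds[OF that] by simp
  have c_abs: "\<bar>c i z\<bar> \<le> C + \<epsilon>" if "i \<in> I" "z \<in> space pairs" for i z
    using close[OF that] g_abs[OF that(1) lump_space[OF that(2)]] by linarith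
  have "\<forall>\<^sub>F T in sequentially. 1 / real T * (\<Sum>t<T. \<integral>z. c i z \<partial>pair_law \<pi> t) < v i + \<eta>" if i: "i \<in> I" for i
  proof -
    have "average_cost S \<gamma> p (c i) \<pi> = limsup (\<lambda>T. ereal (1 / real T * (\<Sum>t<T. \<integral>z. c i z \<partial>pair_law \<pi> t)))"
      by (rule average_cost_eq[OF policy c[OF i] c_abs[OF i]])
    then have "limsup (\<lambda>T. ereal (1 / real T * (\<Sum>t<T. \<integral>z. c i z \<partial>pair_law \<pi> t))) \<le> ereal (v i)"
      using cost[OF i] by simp
    also have "\<dots> < ereal (v i + \<eta>)" using \<eta> by simp
    finally show ?thesis by (auto dest: Limsup_lessD)
  qed
  then have "\<forall>\<^sub>F T in sequentially. \<forall>i\<in>I. 1 / real T * (\<Sum>t<T. \<integral>z. c i z \<partial>pair_law \<pi> t) < v i + \<eta>"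
    using \<open>finite I\<close> by (simp add: eventually_ball_finite)
  moreover have "\<forall>\<^sub>F T in sequentially. 2 / real T < \<eta>"
    using lim_const_over_n[of 2] \<eta> by (rule order_tendstoD)
  ultimately have "\<forall>\<^sub>F T in sequentially. 0 < T \<and> 2 / real T < \<eta> \<and>
      (\<forall>i\<in>I. 1 / real T * (\<Sum>t<T. \<integral>z. c i z \<partial>pair_law \<pi> t) < v i + \<eta>)"
    using eventually_gt_at_top[of 0] by eventually_elim auto
  then obtain T where T: "0 < T" "2 / real T < \<eta>"
    and cost_T: "\<And>i. i \<in> I \<Longrightarrow> 1 / real T * (\<Sum>t<T. \<integral>z. c i z \<partial>pair_law \<pi> t) < v i + \<eta>"
    by (auto dest: eventually_happens)
  obtain \<mu> where \<mu>: "\<mu> \<in> space (prob_algebra cells)" "defect \<mu> \<le> 2 / real T + \<epsilon>"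
    and int: "\<And>f B. f \<in> borel_measurable cells \<Longrightarrow> (\<And>z. z \<in> space cells \<Longrightarrow> \<bar>f z\<bar> \<le> (B::real)) \<Longrightarrow>
      (\<integral>z. f z \<partial>\<mu>) = 1 / real T * (\<Sum>t<T. \<integral>z. f (lump z) \<partial>pair_law \<pi> t)"
    by (rule occupation_measure[OF policy T(1)]) blast
  have "(\<integral>z. g i z \<partial>\<mu>) \<le> v i + \<eta> + \<epsilon>" if i: "i \<in> I" for i
  proof -
    have "(\<integral>z. g i (lump z) \<partial>pair_law \<pi> t) \<le> (\<integral>z. c i z \<partial>pair_law \<pi> t) + \<epsilon>" for t
    proof -
      note law = pair_law_prob[OF policy, of t]
      interpret prob_space "pair_law \<pi> t" using law by (simp add: space_prob_algebra)
      have cl: "integrable (pair_law \<pi> t) (c i)"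
        by (rule integrable_prob_space_bounded[OF law c[OF i] c_abs[OF i]])
      have gl: "integrable (pair_law \<pi> t) (\<lambda>z. g i (lump z))"
        by (rule integrable_prob_space_bounded[OF law measurable_compose[OF lump_measurable g[OF i]]
              g_abs[OF i lump_space]])
      have "(\<integral>z. g i (lump z) \<partial>pair_law \<pi> t) \<le> (\<integral>z. c i z + \<epsilon> \<partial>pair_law \<pi> t)"
      proof (rule integral_mono[OF gl])
        fix z assume "z \<in> space (pair_law \<pi> t)"
        then show "g i (lump z) \<le> c i z + \<epsilon>"
          using close[OF i, of z] space_eq_of_prob_algebra[OF law] by auto
      qed (use cl in simp)
      then show ?thesis using cl by (simp add: prob_space)
    qed
    then have "(\<Sum>t<T. \<integral>z. g i (lump z) \<partial>pair_law \<pi> t) \<le> (\<Sum>t<T. (\<integral>z. c i z \<partial>pair_law \<pi> t) + \<epsilon>)"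
      by (rule sum_mono)
    then have "1 / real T * (\<Sum>t<T. \<integral>z. g i (lump z) \<partial>pair_law \<pi> t)
        \<le> 1 / real T * ((\<Sum>t<T. \<integral>z. c i z \<partial>pair_law \<pi> t) + real T * \<epsilon>)"
      by (intro mult_left_mono) (auto simp: sum.distrib)
    also have "\<dots> = 1 / real T * (\<Sum>t<T. \<integral>z. c i z \<partial>pair_law \<pi> t) + \<epsilon>"
      using T by (simp add: field_simps)
    finally show ?thesis
      using cost_T[OF i] int[OF g[OF i] g_abs[OF i]] by simp
  qed
  moreover have "defect \<mu> \<le> \<eta> + \<epsilon>" using \<mu>(2) T(2) by simp
  ultimately show ?thesis using \<mu>(1) that by blast
qed

end

section \<open>Transfer of policies and of optimal values\<close>

lemma average_cost_bounds:
  assumes "mdp S \<gamma> p" and policy: "\<pi> \<in> policies S"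
    and c: "c \<in> borel_measurable (S \<Otimes>\<^sub>M (borel :: 'a::topological_space measure))"
    and bounds: "\<And>z. z \<in> space (S \<Otimes>\<^sub>M (borel :: 'a measure)) \<Longrightarrow> 0 \<le> c z \<and> c z \<le> C"
  shows "0 \<le> average_cost S \<gamma> p c \<pi>" and "average_cost S \<gamma> p c \<pi> \<le> ereal C"
proof -
  interpret mdp S \<gamma> p by fact
  have c_abs: "\<bar>c z\<bar> \<le> C" if "z \<in> space pairs" for z using bounds[OF that] by simp
  have eq: "average_cost S \<gamma> p c \<pi> = limsup (\<lambda>T. ereal (1 / real T * (\<Sum>t<T. \<integral>z. c z \<partial>pair_law \<pi> t)))"
    by (rule average_cost_eq[OF policy c c_abs])
  have step: "0 \<le> (\<integral>z. c z \<partial>pair_law \<pi> t) \<and> (\<integral>z. c z \<partial>pair_law \<pi> t) \<le> C" for t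
  proof -
    note law = pair_law_prob[OF policy, of t]
    interpret prob_space "pair_law \<pi> t" using law by (simp add: space_prob_algebra)
    have b: "0 \<le> c z \<and> c z \<le> C" if "z \<in> space (pair_law \<pi> t)" for z
      using that bounds space_eq_of_prob_algebra[OF law] by simp
    have "integrable (pair_law \<pi> t) c"
      by (rule integrable_prob_space_bounded[OF law c c_abs])
    then have "(\<integral>z. c z \<partial>pair_law \<pi> t) \<le> (\<integral>z. C \<partial>pair_law \<pi> t)"
      using b by (intro integral_mono) auto
    moreover have "0 \<le> (\<integral>z. c z \<partial>pair_law \<pi> t)"
      using b by (intro Bochner_Integration.integral_nonneg) auto
    ultimately show ?thesis by (simp add: prob_space)
  qed
  have "limsup (\<lambda>T::nat. 0 :: ereal) \<le> average_cost S \<gamma> p c \<pi>"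
    unfolding eq using step by (intro Limsup_mono always_eventually) (auto intro!: sum_nonneg divide_nonneg_nonneg)
  then show "0 \<le> average_cost S \<gamma> p c \<pi>" by (simp add: Limsup_const)
  show "average_cost S \<gamma> p c \<pi> \<le> ereal C"
    unfolding eq using step by (intro limsup_average_le[where \<alpha> = 0 and K = 0]) auto
qed

definition cost_lumps ::
    "'x measure \<Rightarrow> 'y set \<Rightarrow> ('x \<Rightarrow> 'y) \<Rightarrow> real \<Rightarrow> ('x \<times> 'a::topological_space \<Rightarrow> real)
      \<Rightarrow> ('y \<times> 'a \<Rightarrow> real) \<Rightarrow> bool" where
  "cost_lumps S F Q \<epsilon> c g \<longleftrightarrow> c \<in> borel_measurable (S \<Otimes>\<^sub>M borel)
     \<and> g \<in> borel_measurable (count_space F \<Otimes>\<^sub>M borel)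
     \<and> (\<forall>x\<in>space S. \<forall>a. \<bar>c (x, a) - g (Q x, a)\<bar> \<le> \<epsilon>)"

lemma cost_lumpsD:
  assumes "cost_lumps S F Q \<epsilon> c g"
  shows "c \<in> borel_measurable (S \<Otimes>\<^sub>M borel)"
    and "g \<in> borel_measurable (count_space F \<Otimes>\<^sub>M borel)"
    and "z \<in> space (S \<Otimes>\<^sub>M borel) \<Longrightarrow> \<bar>c z - g (Q (fst z), snd z)\<bar> \<le> \<epsilon>"
  using assms by (auto simp: cost_lumps_def space_pair_measure)

text \<open>Three models over one reference chain: \<open>\<pi>0\<close> and \<open>\<pi>1\<close> yield occupation measures, these are mixed,
and the mixture is turned into a policy of the third model. The error comprises \<open>2 \<epsilon>\<close> from the
integrals of the occupation measures, \<open>\<epsilon>\<close> from the cost in the third model, and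
\<open>3 C \<epsilon> / (1 - \<alpha>)\<close> from a defect of at most \<open>2 \<epsilon>\<close> plus the lumping error \<open>\<epsilon>\<close>.\<close>
lemma transfer_policy:
  fixes r :: "'y \<times> 'a::topological_space \<Rightarrow> 'y \<Rightarrow> real"
    and g :: "'i \<Rightarrow> 'y \<times> 'a \<Rightarrow> real"
  assumes M0: "lumped_mdp S0 \<gamma>0 p0 F r L \<alpha> Q0 \<epsilon>"
    and M1: "lumped_mdp S1 \<gamma>1 p1 F r L \<alpha> Q1 \<epsilon>"
    and M2: "lumped_mdp S2 \<gamma>2 p2 F r L \<alpha> Q2 \<epsilon>"
    and I: "finite I" and \<epsilon>: "0 < \<epsilon>" and C: "0 \<le> C"
    and c0: "\<And>i. i \<in> I \<Longrightarrow> cost_lumps S0 F Q0 \<epsilon> (c0 i) (g i)"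
    and c1: "\<And>i. i \<in> I \<Longrightarrow> cost_lumps S1 F Q1 \<epsilon> (c1 i) (g i)"
    and c2: "\<And>i. i \<in> I \<Longrightarrow> cost_lumps S2 F Q2 \<epsilon> (c2 i) (g i)"
    and g: "\<And>i z. i \<in> I \<Longrightarrow> z \<in> F \<times> UNIV \<Longrightarrow> 0 \<le> g i z \<and> g i z \<le> C"
    and \<pi>0: "\<pi>0 \<in> policies S0" and \<pi>1: "\<pi>1 \<in> policies S1"
    and w: "\<And>i. i \<in> I \<Longrightarrow> average_cost S0 \<gamma>0 p0 (c0 i) \<pi>0 \<le> ereal (w i)"
    and v: "\<And>i. i \<in> I \<Longrightarrow> average_cost S1 \<gamma>1 p1 (c1 i) \<pi>1 \<le> ereal (v i)"
    and \<theta>: "0 \<le> \<theta>" "\<theta> \<le> 1"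
  obtains \<pi>2 where "\<pi>2 \<in> policies S2"
    and "\<And>i. i \<in> I \<Longrightarrow> average_cost S2 \<gamma>2 p2 (c2 i) \<pi>2
      \<le> ereal (\<theta> * w i + (1 - \<theta>) * v i + (3 + 3 * C / (1 - \<alpha>)) * \<epsilon>)"
proof -
  interpret M0: lumped_mdp S0 \<gamma>0 p0 F r L \<alpha> Q0 \<epsilon> by fact
  interpret M1: lumped_mdp S1 \<gamma>1 p1 F r L \<alpha> Q1 \<epsilon> by fact
  interpret M2: lumped_mdp S2 \<gamma>2 p2 F r L \<alpha> Q2 \<epsilon> by fact
  have g': "0 \<le> g i z \<and> g i z \<le> C" if "i \<in> I" "z \<in> space M0.cells" for i z
    using g[OF that(1)] that(2) unfolding M0.space_cells by blast
  have g_abs: "\<bar>g i z\<bar> \<le> C" if "i \<in> I" "z \<in> space M0.cells" for i z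
    using g'[OF that] by simp
  obtain \<mu>0 where \<mu>0: "\<mu>0 \<in> space (prob_algebra M0.cells)" "M0.defect \<mu>0 \<le> \<epsilon> + \<epsilon>"
    and cost0: "\<And>i. i \<in> I \<Longrightarrow> (\<integral>z. g i z \<partial>\<mu>0) \<le> w i + \<epsilon> + \<epsilon>"
    by (rule M0.occupation_of_policy[of \<pi>0 I \<epsilon> c0 g C w, OF \<pi>0 I \<epsilon> cost_lumpsD[OF c0] g' w]) blast+
  obtain \<mu>1 where \<mu>1: "\<mu>1 \<in> space (prob_algebra M0.cells)" "M0.defect \<mu>1 \<le> \<epsilon> + \<epsilon>"
    and cost1: "\<And>i. i \<in> I \<Longrightarrow> (\<integral>z. g i z \<partial>\<mu>1) \<le> v i + \<epsilon> + \<epsilon>"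
    by (rule M1.occupation_of_policy[of \<pi>1 I \<epsilon> c1 g C v, OF \<pi>1 I \<epsilon> cost_lumpsD[OF c1] g' v]) blast+
  obtain \<mu> where \<mu>: "\<mu> \<in> space (prob_algebra M0.cells)"
    and defect: "M0.defect \<mu> \<le> \<theta> * M0.defect \<mu>0 + (1 - \<theta>) * M0.defect \<mu>1"
    and mix: "\<And>f B. f \<in> borel_measurable M0.cells \<Longrightarrow> (\<And>z. z \<in> space M0.cells \<Longrightarrow> \<bar>f z\<bar> \<le> (B::real)) \<Longrightarrow>
      (\<integral>z. f z \<partial>\<mu>) = \<theta> * (\<integral>z. f z \<partial>\<mu>0) + (1 - \<theta>) * (\<integral>z. f z \<partial>\<mu>1)"
    by (rule M0.mixture[OF \<mu>0(1) \<mu>1(1) \<theta>]) blast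
  note defect
  also have "\<theta> * M0.defect \<mu>0 + (1 - \<theta>) * M0.defect \<mu>1 \<le> \<theta> * (\<epsilon> + \<epsilon>) + (1 - \<theta>) * (\<epsilon> + \<epsilon>)"
    using \<theta> \<mu>0(2) \<mu>1(2) by (intro add_mono mult_left_mono) auto
  finally have defect2: "M0.defect \<mu> \<le> 2 * \<epsilon>" by (simp add: algebra_simps)
  show ?thesis
  proof (rule that[OF M2.lumped_policy_in_policies[OF \<mu>]])
    fix i assume i: "i \<in> I"
    have "average_cost S2 \<gamma>2 p2 (c2 i) (M2.lumped_policy \<mu>)
        \<le> ereal ((\<integral>z. g i z \<partial>\<mu>) + \<epsilon> + C * ((\<epsilon> + M0.defect \<mu>) / (1 - \<alpha>)))"
      using cost_lumpsD[OF c2[OF i]] g'[OF i] by (intro M2.average_cost_lumped_policy[OF \<mu>] C) auto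
    also have "(\<integral>z. g i z \<partial>\<mu>) = \<theta> * (\<integral>z. g i z \<partial>\<mu>0) + (1 - \<theta>) * (\<integral>z. g i z \<partial>\<mu>1)"
      by (rule mix[OF cost_lumpsD(2)[OF c0[OF i]] g_abs[OF i]])
    finally have "average_cost S2 \<gamma>2 p2 (c2 i) (M2.lumped_policy \<mu>)
        \<le> ereal (\<theta> * (\<integral>z. g i z \<partial>\<mu>0) + (1 - \<theta>) * (\<integral>z. g i z \<partial>\<mu>1) + \<epsilon>
          + C * ((\<epsilon> + M0.defect \<mu>) / (1 - \<alpha>)))" .
    also have "\<dots> \<le> ereal (\<theta> * (w i + \<epsilon> + \<epsilon>) + (1 - \<theta>) * (v i + \<epsilon> + \<epsilon>) + \<epsilon>
          + C * ((\<epsilon> + 2 * \<epsilon>) / (1 - \<alpha>)))"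
      using \<theta> C M0.\<alpha> cost0[OF i] cost1[OF i] defect2
      by (simp only: ereal_less_eq) (intro add_mono mult_left_mono divide_right_mono order_refl; simp)
    also have "\<theta> * (w i + \<epsilon> + \<epsilon>) + (1 - \<theta>) * (v i + \<epsilon> + \<epsilon>) + \<epsilon> + C * ((\<epsilon> + 2 * \<epsilon>) / (1 - \<alpha>)) =
        \<theta> * w i + (1 - \<theta>) * v i + (3 + 3 * C / (1 - \<alpha>)) * \<epsilon>"
      by (simp add: algebra_simps)
    finally show "average_cost S2 \<gamma>2 p2 (c2 i) (M2.lumped_policy \<mu>)
        \<le> ereal (\<theta> * w i + (1 - \<theta>) * v i + (3 + 3 * C / (1 - \<alpha>)) * \<epsilon>)" .
  qed
qed

text \<open>The strictly feasible policy may live in a model other than the source and the target. This matters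
because strict feasibility is known in the original model only, but is needed in both
directions.\<close>
lemma constrained_value_transfer:
  fixes r :: "'y \<times> 'a::topological_space \<Rightarrow> 'y \<Rightarrow> real"
  assumes M0: "lumped_mdp S0 \<gamma>0 p0 F r L \<alpha> Q0 \<epsilon>"
    and M1: "lumped_mdp S1 \<gamma>1 p1 F r L \<alpha> Q1 \<epsilon>"
    and M2: "lumped_mdp S2 \<gamma>2 p2 F r L \<alpha> Q2 \<epsilon>"
    and \<epsilon>: "0 < \<epsilon>"
    and c: "cost_lumps S0 F Q0 \<epsilon> c0 g" "cost_lumps S1 F Q1 \<epsilon> c1 g" "cost_lumps S2 F Q2 \<epsilon> c2 g"
    and d: "\<And>l. l \<in> {1..q} \<Longrightarrow> cost_lumps S0 F Q0 \<epsilon> (d0 l) (h l)"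
      "\<And>l. l \<in> {1..q} \<Longrightarrow> cost_lumps S1 F Q1 \<epsilon> (d1 l) (h l)"
      "\<And>l. l \<in> {1..q} \<Longrightarrow> cost_lumps S2 F Q2 \<epsilon> (d2 l) (h l)"
    and g: "\<And>z. z \<in> F \<times> UNIV \<Longrightarrow> 0 \<le> g z \<and> g z \<le> C"
    and h: "\<And>l z. l \<in> {1..q} \<Longrightarrow> z \<in> F \<times> UNIV \<Longrightarrow> 0 \<le> h l z \<and> h l z \<le> C"
    and c0_bounds: "\<And>z. z \<in> space (S0 \<Otimes>\<^sub>M borel) \<Longrightarrow> 0 \<le> c0 z \<and> c0 z \<le> C"
    and c1_bounds: "\<And>z. z \<in> space (S1 \<Otimes>\<^sub>M borel) \<Longrightarrow> 0 \<le> c1 z \<and> c1 z \<le> C"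
    and C: "0 \<le> C"
    and slater: "\<pi>0 \<in> policies S0"
      "\<And>l. l \<in> {1..q} \<Longrightarrow> average_cost S0 \<gamma>0 p0 (d0 l) \<pi>0 \<le> ereal (k l - \<delta>)"
    and \<theta>: "0 \<le> \<theta>" "\<theta> \<le> 1" and slack: "(3 + 3 * C / (1 - \<alpha>)) * \<epsilon> \<le> \<theta> * \<delta>"
  shows "constrained_value S2 \<gamma>2 p2 c2 q d2 k
    \<le> constrained_value S1 \<gamma>1 p1 c1 q d1 k + ereal (\<theta> * C + (3 + 3 * C / (1 - \<alpha>)) * \<epsilon>)"
proof -
  let ?K = "3 + 3 * C / (1 - \<alpha>)"
  let ?e = "ereal (\<theta> * C + ?K * \<epsilon>)"
  have mdps: "mdp S0 \<gamma>0 p0" "mdp S1 \<gamma>1 p1"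
    using M0 M1 by (simp_all add: lumped_mdp_def)
  have "constrained_value S2 \<gamma>2 p2 c2 q d2 k - ?e \<le> average_cost S1 \<gamma>1 p1 c1 \<pi>1"
    if \<pi>1: "\<pi>1 \<in> policies S1"
      and feasible: "\<And>l. l \<in> {1..q} \<Longrightarrow> average_cost S1 \<gamma>1 p1 (d1 l) \<pi>1 \<le> ereal (k l)" for \<pi>1
  proof -
    note bounds1 = average_cost_bounds[OF mdps(2) \<pi>1 cost_lumpsD(1)[OF c(2)] c1_bounds]
    obtain v0 where v0: "average_cost S1 \<gamma>1 p1 c1 \<pi>1 = ereal v0" "0 \<le> v0"
      using bounds1 by (cases "average_cost S1 \<gamma>1 p1 c1 \<pi>1") auto
    \<comment> \<open>Index \<open>0\<close> stands for the objective, so that all costs are transferred by one policy.\<close>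
    let ?I = "insert 0 {1..q}"
    obtain \<pi>2 where \<pi>2: "\<pi>2 \<in> policies S2" and cost: "\<And>i. i \<in> ?I \<Longrightarrow>
        average_cost S2 \<gamma>2 p2 (if i = 0 then c2 else d2 i) \<pi>2
        \<le> ereal (\<theta> * (if i = 0 then C else k i - \<delta>) + (1 - \<theta>) * (if i = 0 then v0 else k i) + ?K * \<epsilon>)"
    proof (rule transfer_policy[OF M0 M1 M2, of ?I C
          "\<lambda>i. if i = 0 then c0 else d0 i" "\<lambda>i. if i = 0 then g else h i"
          "\<lambda>i. if i = 0 then c1 else d1 i" "\<lambda>i. if i = 0 then c2 else d2 i" \<pi>0 \<pi>1
          "\<lambda>i. if i = 0 then C else k i - \<delta>" "\<lambda>i. if i = 0 then v0 else k i" \<theta>])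
      show "average_cost S0 \<gamma>0 p0 (if i = 0 then c0 else d0 i) \<pi>0 \<le> ereal (if i = 0 then C else k i - \<delta>)"
        if "i \<in> ?I" for i
        using that slater(2) average_cost_bounds(2)[OF mdps(1) slater(1) cost_lumpsD(1)[OF c(1)] c0_bounds]
        by auto
      show "average_cost S1 \<gamma>1 p1 (if i = 0 then c1 else d1 i) \<pi>1 \<le> ereal (if i = 0 then v0 else k i)"
        if "i \<in> ?I" for i
        using that feasible v0 by auto
    qed (use \<epsilon> C c d g h slater(1) \<pi>1 \<theta> in \<open>auto split: if_splits\<close>)
    have "average_cost S2 \<gamma>2 p2 (d2 l) \<pi>2 \<le> ereal (k l)" if l: "l \<in> {1..q}" for l
    proof -
      have "average_cost S2 \<gamma>2 p2 (d2 l) \<pi>2 \<le> ereal (\<theta> * (k l - \<delta>) + (1 - \<theta>) * k l + ?K * \<epsilon>)"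
        using cost[of l] l by simp
      also have "\<dots> \<le> ereal (k l)"
        using slack by (simp add: algebra_simps)
      finally show ?thesis .
    qed
    then have "constrained_value S2 \<gamma>2 p2 c2 q d2 k \<le> average_cost S2 \<gamma>2 p2 c2 \<pi>2"
      unfolding constrained_value_def using \<pi>2 by (intro INF_lower) auto
    also have "\<dots> \<le> ereal (\<theta> * C + (1 - \<theta>) * v0 + ?K * \<epsilon>)"
      using cost[of 0] by simp
    also have "\<dots> \<le> ereal v0 + ?e"
      using \<theta> v0(2) by (simp add: algebra_simps)
    finally show ?thesis unfolding v0(1) by (simp add: ereal_minus_le)
  qed
  then have "constrained_value S2 \<gamma>2 p2 c2 q d2 k - ?e \<le> constrained_value S1 \<gamma>1 p1 c1 q d1 k"
    unfolding constrained_value_def[of S1] by (intro INF_greatest) auto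
  then show ?thesis by (simp add: ereal_minus_le)
qed

lemma constrained_value_nonneg:
  assumes "mdp S \<gamma> p" and "c \<in> borel_measurable (S \<Otimes>\<^sub>M (borel :: 'a::topological_space measure))"
    and "\<And>z. z \<in> space (S \<Otimes>\<^sub>M (borel :: 'a measure)) \<Longrightarrow> 0 \<le> c z \<and> c z \<le> C"
  shows "0 \<le> constrained_value S \<gamma> p c q d k"
  unfolding constrained_value_def using average_cost_bounds(1)[OF assms(1) _ assms(2,3)]
  by (intro INF_greatest) auto

section \<open>Total variation distance\<close>

lemma tv_dist_bdd_above:
  assumes "M \<in> space (prob_algebra N)" "M' \<in> space (prob_algebra N)"
  shows "bdd_above ((\<lambda>D. \<bar>measure M D - measure M' D\<bar>) ` sets M)"
proof (rule bdd_aboveI2)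
  fix D
  show "\<bar>measure M D - measure M' D\<bar> \<le> 1"
    using prob_space.prob_le_1[of M D] prob_space.prob_le_1[of M' D] assms
      measure_nonneg[of M D] measure_nonneg[of M' D]
    unfolding space_prob_algebra mem_Collect_eq abs_le_iff by (intro conjI) linarith+
qed

lemma measure_diff_le_tv_dist:
  assumes "M \<in> space (prob_algebra N)" "M' \<in> space (prob_algebra N)" and D: "D \<in> sets N"
  shows "\<bar>measure M D - measure M' D\<bar> \<le> tv_dist M M' / 2"
proof -
  have "D \<in> sets M" using D assms(1) by (simp add: space_prob_algebra)
  from cSUP_upper[OF this tv_dist_bdd_above[OF assms(1,2)]] show ?thesis
    by (simp add: tv_dist_def)
qed

lemma tv_dist_triangle:
  assumes "M1 \<in> space (prob_algebra N)" "M2 \<in> space (prob_algebra N)" "M \<in> space (prob_algebra N)"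
  shows "tv_dist M1 M2 \<le> tv_dist M1 M + tv_dist M2 M"
proof -
  have "(SUP D\<in>sets M1. \<bar>measure M1 D - measure M2 D\<bar>) \<le> (tv_dist M1 M + tv_dist M2 M) / 2"
  proof (rule cSUP_least)
    fix D assume "D \<in> sets M1"
    then have "D \<in> sets N" using assms(1) by (simp add: space_prob_algebra)
    have "\<bar>measure M1 D - measure M2 D\<bar> \<le> \<bar>measure M1 D - measure M D\<bar> + \<bar>measure M2 D - measure M D\<bar>"
      by (simp add: abs_if)
    also have "\<dots> \<le> tv_dist M1 M / 2 + tv_dist M2 M / 2"
      by (intro add_mono measure_diff_le_tv_dist[OF assms(1,3)] measure_diff_le_tv_dist[OF assms(2,3)] \<open>D \<in> sets N\<close>)
    finally show "\<bar>measure M1 D - measure M2 D\<bar> \<le> (tv_dist M1 M + tv_dist M2 M) / 2"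
      by (simp add: add_divide_distrib)
  qed (use sets.empty_sets in blast)
  then show ?thesis unfolding tv_dist_def[of M1 M2] by simp
qed

lemma tv_dist_self: "tv_dist M M = 0"
proof -
  have "(\<lambda>D. \<bar>measure M D - measure M D\<bar>) ` sets M = {0}"
    using sets.empty_sets[of M] by auto
  then show ?thesis by (simp add: tv_dist_def)
qed

text \<open>Split the cells by the sign of the difference: each of the two unions contributes at most half the
distance, since the distance carries the factor two of the norm of a signed measure.\<close>
lemma partition_sum_le_tv_dist:
  assumes M: "M \<in> space (prob_algebra N)" and M': "M' \<in> space (prob_algebra N)"
    and F: "finite F" and cells: "\<And>y. y \<in> F \<Longrightarrow> A y \<in> sets N" and disj: "disjoint_family_on A F"
  shows "(\<Sum>y\<in>F. \<bar>measure M (A y) - measure M' (A y)\<bar>) \<le> tv_dist M M'"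
proof -
  have additive: "measure R (\<Union>y\<in>G. A y) = (\<Sum>y\<in>G. measure R (A y))"
    if "R \<in> space (prob_algebra N)" "G \<subseteq> F" for R G
  proof -
    interpret prob_space R using that(1) by (simp add: space_prob_algebra)
    show ?thesis
      using that cells disj F
      by (intro finite_measure_finite_Union)
         (auto simp: space_prob_algebra intro: finite_subset disjoint_family_on_mono)
  qed
  have part: "\<bar>\<Sum>y\<in>G. measure M (A y) - measure M' (A y)\<bar> \<le> tv_dist M M' / 2" if "G \<subseteq> F" for G
    using measure_diff_le_tv_dist[OF M M', of "\<Union>y\<in>G. A y"] that F cells
    by (auto simp: additive[OF M that] additive[OF M' that] sum_subtractf
             intro!: sets.finite_UN intro: finite_subset)
  let ?P = "{y \<in> F. measure M' (A y) \<le> measure M (A y)}"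
  have "(\<Sum>y\<in>F. \<bar>measure M (A y) - measure M' (A y)\<bar>) =
      (\<Sum>y\<in>?P. \<bar>measure M (A y) - measure M' (A y)\<bar>) + (\<Sum>y\<in>F - ?P. \<bar>measure M (A y) - measure M' (A y)\<bar>)"
    using F by (subst sum.subset_diff[of ?P F]) (auto intro: add.commute)
  also have "(\<Sum>y\<in>?P. \<bar>measure M (A y) - measure M' (A y)\<bar>) = (\<Sum>y\<in>?P. measure M (A y) - measure M' (A y))"
    by (intro sum.cong) auto
  also have "(\<Sum>y\<in>F - ?P. \<bar>measure M (A y) - measure M' (A y)\<bar>) = - (\<Sum>y\<in>F - ?P. measure M (A y) - measure M' (A y))"
    unfolding sum_negf[symmetric] by (intro sum.cong) auto
  also have "(\<Sum>y\<in>?P. measure M (A y) - measure M' (A y)) + - (\<Sum>y\<in>F - ?P. measure M (A y) - measure M' (A y))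
      \<le> tv_dist M M' / 2 + tv_dist M M' / 2"
    using part[of ?P] part[of "F - ?P"] by (intro add_mono) (auto simp: abs_le_iff)
  finally show ?thesis by simp
qed

text \<open>The Heine-Borel argument for uniform continuity, done by hand because \<open>tv_dist\<close> is a
function on measures and not the metric of a type.\<close>
lemma tv_uniformly_continuous:
  fixes p :: "'z::metric_space \<Rightarrow> 'x measure"
  assumes compact: "compact (UNIV :: 'z set)" and p: "tv_continuous p"
    and prob: "\<And>z. p z \<in> space (prob_algebra N)" and \<epsilon>: "0 < \<epsilon>"
  obtains \<delta> where "0 < \<delta>" and "\<And>z z'. dist z z' < \<delta> \<Longrightarrow> tv_dist (p z) (p z') \<le> \<epsilon>"
proof -
  have "\<exists>\<eta>>0. \<forall>z'. dist z' z < \<eta> \<longrightarrow> tv_dist (p z') (p z) < \<epsilon> / 2" for z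
  proof -
    have "((\<lambda>z'. tv_dist (p z') (p z)) \<longlongrightarrow> 0) (at z)"
      using p by (simp add: tv_continuous_def)
    then have "\<forall>\<^sub>F z' in at z. tv_dist (p z') (p z) < \<epsilon> / 2"
      using \<epsilon> by (intro order_tendstoD(2)) auto
    then obtain \<eta> where "\<eta> > 0" "\<And>z'. z' \<noteq> z \<Longrightarrow> dist z' z < \<eta> \<Longrightarrow> tv_dist (p z') (p z) < \<epsilon> / 2"
      by (auto simp: eventually_at)
    then show ?thesis
      using tv_dist_self[of "p z"] \<epsilon> by (intro exI[of _ \<eta>]) (metis half_gt_zero)
  qed
  then obtain \<eta> where \<eta>: "\<And>z. \<eta> z > 0"
    and near: "\<And>z z'. dist z' z < \<eta> z \<Longrightarrow> tv_dist (p z') (p z) < \<epsilon> / 2"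
    by metis
  have "UNIV \<subseteq> \<Union>(range (\<lambda>z. ball z (\<eta> z)))"
    using \<eta> by auto
  then obtain \<delta> where \<delta>: "0 < \<delta>" "\<And>x. x \<in> UNIV \<Longrightarrow> \<exists>G \<in> range (\<lambda>z. ball z (\<eta> z)). ball x \<delta> \<subseteq> G"
    by (rule Heine_Borel_lemma[OF compact]) auto
  show ?thesis
  proof (rule that[OF \<delta>(1)])
    fix z z' :: 'z assume zz': "dist z z' < \<delta>"
    obtain y where y: "ball z \<delta> \<subseteq> ball y (\<eta> y)" using \<delta>(2)[of z] by auto
    have "z \<in> ball y (\<eta> y)" "z' \<in> ball y (\<eta> y)"
      using y zz' \<delta>(1) by (auto simp: subset_iff)
    then have "tv_dist (p z) (p y) < \<epsilon> / 2" "tv_dist (p z') (p y) < \<epsilon> / 2"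
      by (simp_all add: near dist_commute del: less_divide_eq_numeral1)
    then show "tv_dist (p z) (p z') \<le> \<epsilon>"
      using tv_dist_triangle[OF prob prob prob, of z z' y] by simp
  qed
qed

text \<open>If a family of numbers is \<open>l\<^sup>1\<close>-close to almost every \<open>h x\<close>, it is as close to the mean of \<open>h\<close>. This compares
a point of a cell with the averages that define the finite model.\<close>
lemma sum_abs_diff_integral_le:
  fixes h :: "'j \<Rightarrow> 'b \<Rightarrow> real"
  assumes "prob_space M" and h: "\<And>j. j \<in> J \<Longrightarrow> integrable M (h j)"
    and close: "AE x in M. (\<Sum>j\<in>J. \<bar>u j - h j x\<bar>) \<le> \<epsilon>"
  shows "(\<Sum>j\<in>J. \<bar>u j - (\<integral>x. h j x \<partial>M)\<bar>) \<le> \<epsilon>"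
proof -
  interpret prob_space M by fact
  have "(\<Sum>j\<in>J. \<bar>u j - (\<integral>x. h j x \<partial>M)\<bar>) = (\<Sum>j\<in>J. \<bar>\<integral>x. u j - h j x \<partial>M\<bar>)"
    using h by (intro sum.cong refl) (simp add: prob_space)
  also have "\<dots> \<le> (\<Sum>j\<in>J. \<integral>x. \<bar>u j - h j x\<bar> \<partial>M)"
    by (intro sum_mono integral_abs_bound)
  also have "\<dots> = (\<integral>x. (\<Sum>j\<in>J. \<bar>u j - h j x\<bar>) \<partial>M)"
    using h by (intro Bochner_Integration.integral_sum[symmetric]) auto
  also have "\<dots> \<le> (\<integral>x. \<epsilon> \<partial>M)"
    using h close by (intro integral_mono_AE) auto
  finally show ?thesis by (simp add: prob_space)
qed

section \<open>The finite model and the original model as lumped models\<close>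

text \<open>One discretization, with cells so small that \<open>p\<close> oscillates by at most \<open>\<epsilon>\<close> on each of them. The
metric of the state space enters only when \<open>\<epsilon>\<close> is related to the diameter of the cells.\<close>
locale discretized_mdp = mdp borel \<gamma> p
  for \<gamma> :: "'x::polish_space measure" and p :: "'x \<times> 'a::polish_space \<Rightarrow> 'x measure" +
  fixes F :: "'x set" and Q :: "'x \<Rightarrow> 'x" and \<nu> :: "'x measure" and \<Lambda> :: "'x measure"
    and \<alpha> :: real and \<epsilon> :: real
  assumes finite_F: "finite F"
    and Q: "Q \<in> borel \<rightarrow>\<^sub>M count_space F"
    and \<nu>: "finite_measure \<nu>" "sets \<nu> = sets borel"
    and cell_pos: "\<And>y. y \<in> F \<Longrightarrow> 0 < measure \<nu> (Q -` {y})"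
    and \<Lambda>: "\<Lambda> \<in> space (prob_algebra borel)"
    and \<alpha>: "0 \<le> \<alpha>" "\<alpha> < 1"
    and minorized: "\<And>z D. D \<in> sets borel \<Longrightarrow> (1 - \<alpha>) * measure \<Lambda> D \<le> measure (p z) D"
    and tv_close: "\<And>x x' a. Q x = Q x' \<Longrightarrow> tv_dist (p (x, a)) (p (x', a)) \<le> \<epsilon>"
begin

abbreviation mean :: "'x \<Rightarrow> 'x measure" where
  "mean y \<equiv> cell_measure Q \<nu> y"

definition r :: "'x \<times> 'a \<Rightarrow> 'x \<Rightarrow> real" where
  "r z y' = (\<integral>x. measure (p (x, snd z)) (Q -` {y'}) \<partial>mean (fst z))"

lemma Q_in_F: "Q x \<in> F"
  using measurable_space[OF Q, of x] by simp

lemma cell_borel: "Q -` {y} \<in> sets borel"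
proof (cases "y \<in> F")
  case True
  then show ?thesis using measurable_sets[OF Q, of "{y}"] by simp
next
  case False
  then have "Q -` {y} = {}" using Q_in_F by auto
  then show ?thesis by simp
qed

lemma disjoint_cells: "disjoint_family_on (\<lambda>y. Q -` {y}) F"
  by (auto simp: disjoint_family_on_def)

lemma cells_sum:
  assumes M: "M \<in> space (prob_algebra borel)"
  shows "(\<Sum>y\<in>F. measure M (Q -` {y})) = 1"
proof -
  interpret prob_space M using M by (simp add: space_prob_algebra)
  have "(\<Sum>y\<in>F. measure M (Q -` {y})) = measure M (\<Union>y\<in>F. Q -` {y})"
    using M finite_F cell_borel disjoint_cells
    by (intro finite_measure_finite_Union[symmetric]) (auto simp: space_prob_algebra)
  also have "(\<Union>y\<in>F. Q -` {y}) = space M"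
    using Q_in_F space_eq_of_prob_algebra[OF M] by auto
  finally show ?thesis by (simp add: prob_space)
qed

lemma mean_prob: "y \<in> F \<Longrightarrow> mean y \<in> space (prob_algebra borel)"
proof -
  assume y: "y \<in> F"
  interpret finite_measure \<nu> by (fact \<nu>)
  have "prob_space (mean y)"
    unfolding cell_measure_def using cell_pos[OF y]
    by (intro prob_space_uniform_measure) (auto simp: emeasure_eq_measure)
  then show ?thesis
    by (simp add: space_prob_algebra cell_measure_def uniform_measure_def \<nu>)
qed

text \<open>The averaging measure of a cell lives on that cell, so averages over it only see points that
share the cell.\<close>
lemma AE_mean: "AE x in mean y. Q x = y"
  unfolding cell_measure_def using cell_borel by (intro AE_uniform_measureI) (auto simp: \<nu>)

lemma p_prob: "p z \<in> space (prob_algebra borel)"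
  using measurable_space[OF kernel, of z] by (simp add: space_pair_measure)

lemma section_measurable: "g \<in> borel_measurable pairs \<Longrightarrow> (\<lambda>x. g (x, a)) \<in> borel_measurable borel"
  by (rule measurable_compose[OF measurable_Pair2']) simp_all

lemma cell_probability_measurable: "(\<lambda>z. measure (p z) (Q -` {y})) \<in> borel_measurable pairs"
  by (rule measurable_compose[OF kernel measurable_measure_prob_algebra[OF cell_borel]])

lemma cell_probability_bounded: "\<bar>measure (p z) (Q -` {y})\<bar> \<le> 1"
  using p_prob[of z] by (auto simp: space_prob_algebra prob_space.prob_le_1)

lemma mean_integrable:
  fixes g :: "'x \<times> 'a \<Rightarrow> real"
  assumes "y \<in> F" and "g \<in> borel_measurable pairs" and "\<And>z. \<bar>g z\<bar> \<le> B"
  shows "integrable (mean y) (\<lambda>x. g (x, a))"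
  by (rule integrable_prob_space_bounded[OF mean_prob[OF assms(1)] section_measurable[OF assms(2)] assms(3)])

lemma mean_measurable:
  fixes g :: "'x \<times> 'a \<Rightarrow> real"
  assumes g: "g \<in> borel_measurable pairs"
  shows "(\<lambda>z. \<integral>x. g (x, snd z) \<partial>mean (fst z)) \<in> borel_measurable (count_space F \<Otimes>\<^sub>M borel)"
proof (rule measurable_pair_measure_countable1[OF countable_finite[OF finite_F]])
  fix y assume y: "y \<in> F"
  interpret prob_space "mean y" using mean_prob[OF y] by (simp add: space_prob_algebra)
  have sets: "sets (mean y) = sets borel" using mean_prob[OF y] by (simp add: space_prob_algebra)
  have "(\<lambda>z. g (snd z, fst z)) \<in> borel_measurable (borel \<Otimes>\<^sub>M mean y)"
    unfolding measurable_cong_sets[OF sets_pair_measure_cong[OF refl sets] refl]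
    by (rule measurable_compose[OF measurable_Pair[OF measurable_snd measurable_fst] g])
  then have "(\<lambda>(a, x). g (x, a)) \<in> borel_measurable (borel \<Otimes>\<^sub>M mean y)"
    by (simp add: split_beta')
  then have "(\<lambda>a. \<integral>x. g (x, a) \<partial>mean y) \<in> borel_measurable borel"
    by (rule borel_measurable_lebesgue_integral)
  then show "(\<lambda>a. \<integral>x. g (x, snd (y, a)) \<partial>mean (fst (y, a))) \<in> borel_measurable borel" by simp
qed

lemma r_sum: "y \<in> F \<Longrightarrow> (\<Sum>y'\<in>F. r (y, a) y') = 1"
proof -
  assume y: "y \<in> F"
  interpret prob_space "mean y" using mean_prob[OF y] by (simp add: space_prob_algebra)
  have "(\<Sum>y'\<in>F. r (y, a) y') = (\<integral>x. (\<Sum>y'\<in>F. measure (p (x, a)) (Q -` {y'})) \<partial>mean y)"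
    unfolding r_def
    by (simp add: Bochner_Integration.integral_sum
        mean_integrable[OF y cell_probability_measurable cell_probability_bounded])
  then show ?thesis by (simp add: cells_sum[OF p_prob] prob_space)
qed

lemma r_minorized: "y \<in> F \<Longrightarrow> (1 - \<alpha>) * measure \<Lambda> (Q -` {y'}) \<le> r (y, a) y'"
proof -
  assume y: "y \<in> F"
  interpret prob_space "mean y" using mean_prob[OF y] by (simp add: space_prob_algebra)
  have "(\<integral>x. (1 - \<alpha>) * measure \<Lambda> (Q -` {y'}) \<partial>mean y) \<le> (\<integral>x. measure (p (x, a)) (Q -` {y'}) \<partial>mean y)"
    by (intro integral_mono mean_integrable[OF y cell_probability_measurable cell_probability_bounded]
        minorized cell_borel) simp
  then show ?thesis by (simp add: r_def prob_space)
qed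

lemma reference: "reference_chain F r (\<lambda>y. measure \<Lambda> (Q -` {y})) \<alpha>"
proof
  show "(\<lambda>z. r z y') \<in> borel_measurable (count_space F \<Otimes>\<^sub>M borel)" for y'
    unfolding r_def by (rule mean_measurable[OF cell_probability_measurable])
qed (auto simp: finite_F r_sum r_minorized cells_sum[OF \<Lambda>] \<alpha>)

lemma r_nonneg: "0 \<le> r z y'"
  unfolding r_def by (rule Bochner_Integration.integral_nonneg) simp

text \<open>The probabilities of the cells are averaged over starting points within one cell, and such points
have transition laws within \<open>\<epsilon>\<close> in total variation.\<close>
lemma lumped_original: "lumped_mdp borel \<gamma> p F r (\<lambda>y. measure \<Lambda> (Q -` {y})) \<alpha> Q \<epsilon>"
proof (intro lumped_mdp.intro lumped_mdp_axioms.intro reference mdp_axioms Q)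
  fix x a
  have "(\<Sum>y'\<in>F. \<bar>measure (p (x, a)) (Q -` {y'}) - r (Q x, a) y'\<bar>) \<le> \<epsilon>"
    unfolding r_def fst_conv snd_conv
  proof (rule sum_abs_diff_integral_le)
    show "prob_space (mean (Q x))" using mean_prob[OF Q_in_F] by (simp add: space_prob_algebra)
    show "integrable (mean (Q x)) (\<lambda>x'. measure (p (x', a)) (Q -` {y'}))" for y'
      by (rule mean_integrable[OF Q_in_F cell_probability_measurable cell_probability_bounded])
    show "AE x' in mean (Q x). (\<Sum>y'\<in>F. \<bar>measure (p (x, a)) (Q -` {y'}) - measure (p (x', a)) (Q -` {y'})\<bar>) \<le> \<epsilon>"
      using AE_mean[of "Q x"]
    proof eventually_elim
      case (elim x')
      have "(\<Sum>y'\<in>F. \<bar>measure (p (x, a)) (Q -` {y'}) - measure (p (x', a)) (Q -` {y'})\<bar>)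
          \<le> tv_dist (p (x, a)) (p (x', a))"
        by (rule partition_sum_le_tv_dist[OF p_prob p_prob finite_F cell_borel disjoint_cells])
      also have "\<dots> \<le> \<epsilon>" by (rule tv_close) (simp add: elim)
      finally show ?case .
    qed
  qed
  then show "(\<Sum>y'\<in>F. \<bar>measure (p (x, a)) (Q -` {y'} \<inter> space borel) - r (Q x, a) y'\<bar>) \<le> \<epsilon>" by simp
qed

lemma finite_kernel_eq: "finite_kernel F Q \<nu> p z = point_measure F (\<lambda>y'. ennreal (r z y'))"
  by (simp add: finite_kernel_def r_def split_beta')

lemma emeasure_finite_kernel:
  assumes "A \<subseteq> F"
  shows "emeasure (finite_kernel F Q \<nu> p z) A = ennreal (\<Sum>y'\<in>A. r z y')"
  using assms finite_F
  by (simp add: finite_kernel_eq emeasure_point_measure_finite2 finite_subset sum_ennreal r_nonneg)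

lemma space_finite_kernel: "space (finite_kernel F Q \<nu> p z) = F"
  by (simp add: finite_kernel_eq space_point_measure)

lemma finite_kernel_measurable:
  "finite_kernel F Q \<nu> p \<in> count_space F \<Otimes>\<^sub>M borel \<rightarrow>\<^sub>M prob_algebra (count_space F)"
proof (rule measurable_prob_algebra_generated[where \<Omega> = F and G = "Pow F"])
  show "sets (count_space F) = sigma_sets F (Pow F)"
    by (metis sets_count_space sets_measure_of_conv sets.sigma_sets_eq space_count_space)
  show "Int_stable (Pow F)" by (auto simp: Int_stable_def)
  fix z :: "'x \<times> 'a" assume "z \<in> space (count_space F \<Otimes>\<^sub>M borel)"
  then have z: "fst z \<in> F" by (auto simp: space_pair_measure)
  show "prob_space (finite_kernel F Q \<nu> p z)"
    using r_sum[OF z, of "snd z"]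
    by (intro prob_spaceI) (simp add: space_finite_kernel emeasure_finite_kernel)
  show "sets (finite_kernel F Q \<nu> p z) = sets (count_space F)"
    by (simp add: finite_kernel_eq sets_point_measure)
next
  fix A assume "A \<in> Pow F"
  then have A: "A \<subseteq> F" by simp
  show "(\<lambda>z. emeasure (finite_kernel F Q \<nu> p z) A) \<in> borel_measurable (count_space F \<Otimes>\<^sub>M borel)"
    unfolding emeasure_finite_kernel[OF A]
    by (intro measurable_compose[OF _ measurable_ennreal] borel_measurable_sum
        reference_chain.r_measurable[OF reference]) (use A in auto)
qed auto

lemma mdp_finite: "mdp (count_space F) (finite_initial F Q \<gamma>) (finite_kernel F Q \<nu> p)"
proof
  show "finite_initial F Q \<gamma> \<in> space (prob_algebra (count_space F))"
    unfolding finite_initial_def by (rule distr_in_prob_algebra[OF initial Q])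
qed (rule finite_kernel_measurable)

lemma \<epsilon>_nonneg: "0 \<le> \<epsilon>"
  using tv_close[OF refl, of undefined undefined] by (simp add: tv_dist_self)

text \<open>The reference chain is by construction the transition law of the finite model, so there is no
error here; \<open>\<epsilon>\<close> appears only to match the original model.\<close>
lemma lumped_finite:
  "lumped_mdp (count_space F) (finite_initial F Q \<gamma>) (finite_kernel F Q \<nu> p) F r
     (\<lambda>y. measure \<Lambda> (Q -` {y})) \<alpha> (\<lambda>y. y) \<epsilon>"
proof (intro lumped_mdp.intro lumped_mdp_axioms.intro reference mdp_finite)
  fix y a assume "y \<in> space (count_space F)"
  then have y: "y \<in> F" by simp
  have "measure (finite_kernel F Q \<nu> p (y, a)) ((\<lambda>y. y) -` {y'} \<inter> space (count_space F)) = r (y, a) y'"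
    if "y' \<in> F" for y'
  proof -
    have "(\<lambda>y. y) -` {y'} \<inter> space (count_space F) = {y'}" using that by auto
    then show ?thesis
      using emeasure_finite_kernel[of "{y'}" "(y, a)"] that by (simp add: measure_def r_nonneg)
  qed
  then show "(\<Sum>y'\<in>F. \<bar>measure (finite_kernel F Q \<nu> p (y, a)) ((\<lambda>y. y) -` {y'} \<inter> space (count_space F))
      - r (y, a) y'\<bar>) \<le> \<epsilon>"
    using \<epsilon>_nonneg by simp
qed simp

lemma finite_cost_eq: "finite_cost Q \<nu> c z = (\<integral>x. c (x, snd z) \<partial>mean (fst z))"
  by (simp add: finite_cost_def split_beta')

lemma finite_cost_bounds:
  assumes c: "c \<in> borel_measurable pairs" and bounds: "\<And>z. 0 \<le> c z \<and> c z \<le> C"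
    and z: "z \<in> F \<times> UNIV"
  shows "0 \<le> finite_cost Q \<nu> c z \<and> finite_cost Q \<nu> c z \<le> C"
proof -
  have y: "fst z \<in> F" using z by auto
  interpret prob_space "mean (fst z)" using mean_prob[OF y] by (simp add: space_prob_algebra)
  have "integrable (mean (fst z)) (\<lambda>x. c (x, snd z))"
    using bounds by (intro mean_integrable[OF y c, of C]) (auto simp: abs_le_iff intro: order_trans)
  then have "(\<integral>x. c (x, snd z) \<partial>mean (fst z)) \<le> (\<integral>x. C \<partial>mean (fst z))"
    using bounds by (intro integral_mono) auto
  then show ?thesis
    using bounds by (simp add: finite_cost_eq prob_space Bochner_Integration.integral_nonneg)
qed

lemma finite_cost_lumps:
  assumes c: "c \<in> borel_measurable pairs" and bounds: "\<And>z. 0 \<le> c z \<and> c z \<le> C"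
    and close: "\<And>x x' a. Q x = Q x' \<Longrightarrow> \<bar>c (x, a) - c (x', a)\<bar> \<le> \<epsilon>"
  shows "cost_lumps borel F Q \<epsilon> c (finite_cost Q \<nu> c)"
    and "cost_lumps (count_space F) F (\<lambda>y. y) \<epsilon> (finite_cost Q \<nu> c) (finite_cost Q \<nu> c)"
proof -
  have meas: "finite_cost Q \<nu> c \<in> borel_measurable (count_space F \<Otimes>\<^sub>M borel)"
    using mean_measurable[OF c] by (simp add: finite_cost_eq[abs_def])
  have abs: "\<bar>c z\<bar> \<le> C" for z using bounds[of z] by simp
  have "(\<Sum>j\<in>{()}. \<bar>c (x, a) - (\<integral>x'. c (x', a) \<partial>mean (Q x))\<bar>) \<le> \<epsilon>" for x a
  proof (rule sum_abs_diff_integral_le)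
    show "prob_space (mean (Q x))" using mean_prob[OF Q_in_F] by (simp add: space_prob_algebra)
    show "integrable (mean (Q x)) (\<lambda>x'. c (x', a))"
      by (rule mean_integrable[OF Q_in_F c abs])
    show "AE x' in mean (Q x). (\<Sum>j\<in>{()}. \<bar>c (x, a) - c (x', a)\<bar>) \<le> \<epsilon>"
      using AE_mean[of "Q x"] by eventually_elim (simp add: close)
  qed
  with c meas show "cost_lumps borel F Q \<epsilon> c (finite_cost Q \<nu> c)"
    by (simp add: cost_lumps_def finite_cost_eq)
  show "cost_lumps (count_space F) F (\<lambda>y. y) \<epsilon> (finite_cost Q \<nu> c) (finite_cost Q \<nu> c)"
    using meas \<epsilon>_nonneg by (simp add: cost_lumps_def)
qed

text \<open>Both inequalities come from \<open>constrained_value_transfer\<close> with source and target exchanged. They bound the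
absolute difference only because both values are finite: the original problem is feasible, and the
transfer carries this over to the finite one.\<close>
lemma constrained_values_close:
  assumes \<epsilon>: "0 < \<epsilon>" and C: "0 \<le> C"
    and c: "c \<in> borel_measurable pairs" "\<And>z. 0 \<le> c z \<and> c z \<le> C"
      "\<And>x x' a. Q x = Q x' \<Longrightarrow> \<bar>c (x, a) - c (x', a)\<bar> \<le> \<epsilon>"
    and d: "\<And>l. l \<in> {1..q} \<Longrightarrow> d l \<in> borel_measurable pairs"
      "\<And>l z. l \<in> {1..q} \<Longrightarrow> 0 \<le> d l z \<and> d l z \<le> C"
      "\<And>l x x' a. l \<in> {1..q} \<Longrightarrow> Q x = Q x' \<Longrightarrow> \<bar>d l (x, a) - d l (x', a)\<bar> \<le> \<epsilon>"
    and slater: "\<pi>0 \<in> policies borel"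
      "\<And>l. l \<in> {1..q} \<Longrightarrow> average_cost borel \<gamma> p (d l) \<pi>0 \<le> ereal (k l - \<delta>)"
    and \<theta>: "0 \<le> \<theta>" "\<theta> \<le> 1" and \<delta>: "0 \<le> \<delta>"
    and slack: "(3 + 3 * C / (1 - \<alpha>)) * \<epsilon> \<le> \<theta> * \<delta>"
  shows "\<bar>constrained_value (count_space F) (finite_initial F Q \<gamma>) (finite_kernel F Q \<nu> p)
        (finite_cost Q \<nu> c) q (\<lambda>l. finite_cost Q \<nu> (d l)) k - constrained_value borel \<gamma> p c q d k\<bar>
      \<le> ereal (\<theta> * C + (3 + 3 * C / (1 - \<alpha>)) * \<epsilon>)"
proof -
  let ?V = "constrained_value borel \<gamma> p c q d k"
  let ?W = "constrained_value (count_space F) (finite_initial F Q \<gamma>) (finite_kernel F Q \<nu> p)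
        (finite_cost Q \<nu> c) q (\<lambda>l. finite_cost Q \<nu> (d l)) k"
  let ?e = "\<theta> * C + (3 + 3 * C / (1 - \<alpha>)) * \<epsilon>"
  note lump_c = finite_cost_lumps[OF c] and lump_d = finite_cost_lumps[OF d]
  note bound_c = finite_cost_bounds[OF c(1,2)] and bound_d = finite_cost_bounds[OF d(1,2)]
  have fin_bounds: "0 \<le> finite_cost Q \<nu> c z \<and> finite_cost Q \<nu> c z \<le> C"
    if "z \<in> space (count_space F \<Otimes>\<^sub>M borel)" for z
    using that bound_c by (simp add: space_pair_measure)
  have WV: "?W \<le> ?V + ereal ?e"
    by (rule constrained_value_transfer[OF lumped_original lumped_original lumped_finite \<epsilon>
          lump_c(1) lump_c(1) lump_c(2) lump_d(1) lump_d(1) lump_d(2) bound_c bound_d c(2) c(2) C slater \<theta> slack])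
  have VW: "?V \<le> ?W + ereal ?e"
    by (rule constrained_value_transfer[OF lumped_original lumped_finite lumped_original \<epsilon>
          lump_c(1) lump_c(2) lump_c(1) lump_d(1) lump_d(2) lump_d(1) bound_c bound_d c(2) fin_bounds C slater \<theta> slack])
  have V0: "0 \<le> ?V"
    by (rule constrained_value_nonneg[OF mdp_axioms c(1) c(2)])
  have W0: "0 \<le> ?W"
    by (rule constrained_value_nonneg[OF mdp_finite cost_lumpsD(2)[OF lump_c(1)] fin_bounds])
  have "?V \<le> average_cost borel \<gamma> p c \<pi>0"
  proof -
    have "average_cost borel \<gamma> p (d l) \<pi>0 \<le> ereal (k l)" if "l \<in> {1..q}" for l
      using slater(2)[OF that] \<delta> by (auto intro: order_trans)
    then show ?thesis
      unfolding constrained_value_def using slater(1) by (intro INF_lower) auto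
  qed
  also have "\<dots> \<le> ereal C"
    by (rule average_cost_bounds(2)[OF mdp_axioms slater(1) c(1) c(2)])
  finally obtain V where V: "?V = ereal V" using V0 by (cases ?V) auto
  obtain W where W: "?W = ereal W" using WV W0 unfolding V by (cases ?W) auto
  show ?thesis using WV VW unfolding V W by (simp add: abs_le_iff)
qed

end

section \<open>Uniform estimates and convergence of the optimal values\<close>

lemma uniformly_small_oscillation:
  fixes f :: "'x::metric_space \<times> 'a::metric_space \<Rightarrow> real"
  assumes "compact (UNIV :: ('x \<times> 'a) set)" and "continuous_on UNIV f" and "0 < \<epsilon>"
  obtains \<delta> where "0 < \<delta>" and "\<And>x x' a. dist x x' < \<delta> \<Longrightarrow> \<bar>f (x, a) - f (x', a)\<bar> \<le> \<epsilon>"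
proof -
  have "uniformly_continuous_on UNIV f"
    using assms by (intro compact_uniformly_continuous)
  then obtain \<delta> where "0 < \<delta>" "\<And>z z'. dist z' z < \<delta> \<Longrightarrow> dist (f z') (f z) < \<epsilon>"
    using \<open>0 < \<epsilon>\<close> unfolding uniformly_continuous_on_def by (metis UNIV_I)
  then show ?thesis
    by (intro that[of \<delta>]) (auto simp: dist_Pair_Pair dist_real_def less_imp_le)
qed

lemma common_strict_slack:
  fixes u :: "'i \<Rightarrow> ereal"
  assumes "finite I" and "\<And>i. i \<in> I \<Longrightarrow> u i < ereal (k i)"
  obtains \<delta> where "0 < \<delta>" and "\<And>i. i \<in> I \<Longrightarrow> u i \<le> ereal (k i - \<delta>)"
proof -
  have "\<exists>\<delta>>0. u i \<le> ereal (k i - \<delta>)" if i: "i \<in> I" for i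
  proof -
    obtain v where v: "u i < ereal v" "v < k i"
      using ereal_dense2[OF assms(2)[OF i]] by auto
    then show ?thesis by (intro exI[of _ "k i - v"]) auto
  qed
  then obtain \<delta> where \<delta>: "\<And>i. i \<in> I \<Longrightarrow> 0 < \<delta> i" "\<And>i. i \<in> I \<Longrightarrow> u i \<le> ereal (k i - \<delta> i)"
    by metis
  let ?m = "Min (insert 1 (\<delta> ` I))"
  have "0 < ?m" using \<open>finite I\<close> \<delta>(1) by (subst Min_gr_iff) auto
  moreover have "u i \<le> ereal (k i - ?m)" if "i \<in> I" for i
  proof -
    have "?m \<le> \<delta> i" using \<open>finite I\<close> that by (intro Min_le) auto
    then show ?thesis using \<delta>(2)[OF that] by (auto elim!: order_trans)
  qed
  ultimately show ?thesis using that by blast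
qed

lemma uniform_bound:
  fixes f :: "'i \<Rightarrow> 'z::topological_space \<Rightarrow> real"
  assumes "compact (UNIV :: 'z set)" and "finite I" and "\<And>i. i \<in> I \<Longrightarrow> continuous_on UNIV (f i)"
  obtains C where "1 \<le> C" and "\<And>i z. i \<in> I \<Longrightarrow> f i z \<le> C"
proof -
  have "\<exists>B. \<forall>z. f i z \<le> B" if "i \<in> I" for i
    using compact_imp_bounded[OF compact_continuous_image[OF assms(3)[OF that] assms(1)]]
    by (auto simp: bounded_iff abs_le_iff)
  then obtain B where B: "\<And>i z. i \<in> I \<Longrightarrow> f i z \<le> B i" by metis
  let ?C = "Max (insert 1 (B ` I))"
  have "1 \<le> ?C" using \<open>finite I\<close> by simp
  moreover have "f i z \<le> ?C" if "i \<in> I" for i z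
  proof -
    have "B i \<le> ?C" using \<open>finite I\<close> that by (intro Max_ge) auto
    then show ?thesis using B[OF that, of z] by linarith
  qed
  ultimately show ?thesis using that by blast
qed

lemma common_modulus:
  assumes "finite I" and "\<And>i. i \<in> I \<Longrightarrow> \<exists>\<delta>>0. \<forall>x x'. dist x x' < \<delta> \<longrightarrow> P i x x'"
  obtains \<delta> :: real where "0 < \<delta>" and "\<And>i x x'. i \<in> I \<Longrightarrow> dist x x' < \<delta> \<Longrightarrow> P i x x'"
proof -
  from assms(2) obtain \<delta> where \<delta>: "\<And>i. i \<in> I \<Longrightarrow> 0 < \<delta> i"
    "\<And>i x x'. i \<in> I \<Longrightarrow> dist x x' < \<delta> i \<Longrightarrow> P i x x'" by metis
  let ?m = "Min (insert 1 (\<delta> ` I))"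
  have "0 < ?m" using \<open>finite I\<close> \<delta>(1) by (subst Min_gr_iff) auto
  moreover have "?m \<le> \<delta> i" if "i \<in> I" for i using \<open>finite I\<close> that by (intro Min_le) auto
  ultimately show ?thesis using \<delta>(2) that by (metis order_less_le_trans)
qed

theorem theorem5:
  fixes p :: "'x::polish_space \<times> 'a::polish_space \<Rightarrow> 'x measure"
    and c :: "'x \<times> 'a \<Rightarrow> real"
    and q :: nat
    and d :: "nat \<Rightarrow> 'x \<times> 'a \<Rightarrow> real"
    and k :: "nat \<Rightarrow> real"
    and \<gamma> :: "'x measure"
    and F :: "nat \<Rightarrow> 'x set"
    and Q :: "nat \<Rightarrow> 'x \<Rightarrow> 'x"
    and \<nu> :: "nat \<Rightarrow> 'x measure"
    and \<Lambda> :: "'x measure"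
    and \<alpha> :: real
    and \<phi> :: "'x \<times> 'a \<Rightarrow> real"
  assumes "compact (UNIV :: 'x set)"
    and "compact (UNIV :: 'a set)"
    and "p \<in> borel \<Otimes>\<^sub>M borel \<rightarrow>\<^sub>M prob_algebra borel"
    and "continuous_on UNIV c" and "\<And>z. 0 \<le> c z"
    and "\<And>l. l \<in> {1..q} \<Longrightarrow> continuous_on UNIV (d l)"
    and "\<And>l z. l \<in> {1..q} \<Longrightarrow> 0 \<le> d l z"
    and "\<And>l. l \<in> {1..q} \<Longrightarrow> 0 \<le> k l"
    and "prob_space \<gamma>" and "sets \<gamma> = sets borel"
    and "\<exists>\<pi>\<in>policies borel. \<forall>l\<in>{1..q}. average_cost borel \<gamma> p (d l) \<pi> < ereal (k l)"
    and "\<And>n. n \<ge> 1 \<Longrightarrow> finite (F n)"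
    and "\<And>n x. n \<ge> 1 \<Longrightarrow> \<exists>y\<in>F n. dist x y < 1 / real n"
    and "\<And>n. n \<ge> 1 \<Longrightarrow> nearest_point_map (F n) (Q n)"
    and "\<And>n. n \<ge> 1 \<Longrightarrow> finite_measure (\<nu> n)"
    and "\<And>n. n \<ge> 1 \<Longrightarrow> sets (\<nu> n) = sets borel"
    and "\<And>n y. n \<ge> 1 \<Longrightarrow> y \<in> F n \<Longrightarrow> 0 < measure (\<nu> n) (Q n -` {y})"
    and "tv_continuous p"
    and "prob_space \<Lambda>" and "sets \<Lambda> = sets borel"
    and "0 < \<alpha>" and "\<alpha> < 1"
    and "\<phi> \<in> borel_measurable (borel \<Otimes>\<^sub>M borel)" and "bounded (range \<phi>)"
    and "\<And>z D. D \<in> sets borel \<Longrightarrow> measure (p z) D \<ge> measure \<Lambda> D * \<phi> z"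
    and "\<And>z. 1 - \<alpha> \<le> \<phi> z"
  shows "(\<lambda>n. \<bar>constrained_value (count_space (F n)) (finite_initial (F n) (Q n) \<gamma>)
                   (finite_kernel (F n) (Q n) (\<nu> n) p) (finite_cost (Q n) (\<nu> n) c)
                   q (\<lambda>l. finite_cost (Q n) (\<nu> n) (d l)) k
                 - constrained_value borel \<gamma> p c q d k\<bar>) \<longlonglongrightarrow> (0 :: ereal)"
    (is "?gap \<longlonglongrightarrow> 0")
proof -
  note cX = assms(1) and cA = assms(2) and kernel = assms(3) and c = assms(4,5) and d = assms(6,7)
    and gam = assms(9,10) and slater = assms(11) and F = assms(12,13) and Q = assms(14)
    and nu = assms(15-17) and tv = assms(18) and lam = assms(19,20) and al = assms(21,22)
    and minor = assms(25,26)
  have compact: "compact (UNIV :: ('x \<times> 'a) set)"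
    using compact_Times[OF cX cA] by simp
  have p_prob: "p z \<in> space (prob_algebra borel)" for z
    using measurable_space[OF kernel, of z] by (simp add: space_pair_measure)
  obtain C1 where C1: "1 \<le> C1" "\<And>l z. l \<in> {1..q} \<Longrightarrow> d l z \<le> C1"
    by (rule uniform_bound[OF compact finite_atLeastAtMost d(1)]) blast+
  obtain C2 where C2: "1 \<le> C2" "\<And>i z. i \<in> {()} \<Longrightarrow> c z \<le> C2"
    by (rule uniform_bound[OF compact finite.insertI[OF finite.emptyI], where f = "\<lambda>_. c", OF c(1)]) blast+
  define C where "C = max C1 C2"
  have C: "1 \<le> C" and c_C: "\<And>z. c z \<le> C" and d_C: "\<And>l z. l \<in> {1..q} \<Longrightarrow> d l z \<le> C"
    using C1 C2 by (auto simp: C_def intro: max.coboundedI1 max.coboundedI2)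
  obtain \<pi>0 where \<pi>0: "\<pi>0 \<in> policies borel"
    and strict: "\<And>l. l \<in> {1..q} \<Longrightarrow> average_cost borel \<gamma> p (d l) \<pi>0 < ereal (k l)"
    using slater by blast
  obtain \<delta> where \<delta>: "0 < \<delta>"
    and slack: "\<And>l. l \<in> {1..q} \<Longrightarrow> average_cost borel \<gamma> p (d l) \<pi>0 \<le> ereal (k l - \<delta>)"
    by (rule common_strict_slack[OF finite_atLeastAtMost strict]) blast+
  have "\<forall>\<^sub>F n in sequentially. ?gap n < ereal e" if e: "0 < e" for e
  proof -
    define K where "K = 3 + 3 * C / (1 - \<alpha>)"
    \<comment> \<open>The weight \<open>\<theta>\<close> keeps the loss \<open>\<theta> C\<close> in the objective below \<open>e / 4\<close>; the mesh \<open>\<epsilon>\<close> makes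
      the transfer error \<open>K \<epsilon>\<close> fit into the gained slack \<open>\<theta> \<delta>\<close> and below \<open>e / 2\<close>.\<close>
    define \<theta> where "\<theta> = min 1 (e / (4 * C))"
    define \<epsilon> where "\<epsilon> = min (\<theta> * \<delta>) (e / 2) / K"
    have K: "0 < K" using C al by (simp add: K_def add_pos_nonneg)
    have \<theta>: "0 < \<theta>" "\<theta> \<le> 1" "\<theta> * C \<le> e / 4"
      using C e by (auto simp: \<theta>_def min_def field_simps)
    have \<epsilon>: "0 < \<epsilon>" "K * \<epsilon> \<le> \<theta> * \<delta>" "K * \<epsilon> \<le> e / 2"
      using K \<theta> \<delta> e by (auto simp: \<epsilon>_def)
    have "\<exists>\<eta>>0. \<forall>x x'. dist x x' < \<eta> \<longrightarrow> (\<forall>a. \<bar>d l (x, a) - d l (x', a)\<bar> \<le> \<epsilon>)" if "l \<in> {1..q}" for l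
      by (rule uniformly_small_oscillation[OF compact d(1)[OF that] \<epsilon>(1)]) blast
    note d_modulus = this
    obtain \<eta>1 where \<eta>1: "0 < \<eta>1" and
      d_osc: "\<And>l x x'. l \<in> {1..q} \<Longrightarrow> dist x x' < \<eta>1 \<Longrightarrow> \<forall>a. \<bar>d l (x, a) - d l (x', a)\<bar> \<le> \<epsilon>"
      by (rule common_modulus[OF finite_atLeastAtMost d_modulus]) blast+
    obtain \<eta>2 where \<eta>2: "0 < \<eta>2" and
      c_osc: "\<And>x x' a. dist x x' < \<eta>2 \<Longrightarrow> \<bar>c (x, a) - c (x', a)\<bar> \<le> \<epsilon>"
      by (rule uniformly_small_oscillation[OF compact c(1) \<epsilon>(1)]) blast
    obtain \<eta>3 where \<eta>3: "0 < \<eta>3" and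
      p_osc: "\<And>z z'. dist z z' < \<eta>3 \<Longrightarrow> tv_dist (p z) (p z') \<le> \<epsilon>"
      by (rule tv_uniformly_continuous[OF compact tv p_prob \<epsilon>(1)]) blast
    define \<eta> where "\<eta> = min \<eta>1 (min \<eta>2 \<eta>3)"
    have "0 < \<eta>" using \<eta>1 \<eta>2 \<eta>3 by (simp add: \<eta>_def)
    then have "\<forall>\<^sub>F n in sequentially. 2 / real n < \<eta>"
      using lim_const_over_n[of 2] by (intro order_tendstoD)
    then show ?thesis
      using eventually_ge_at_top[of 1]
    proof eventually_elim
      case (elim n)
      \<comment> \<open>Two points with the same nearest point are each within \<open>1 / n\<close> of it.\<close>
      have near: "dist x x' < \<eta>" if "Q n x = Q n x'" for x x'
      proof -
        have "dist x (Q n x) < 1 / real n" for x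
          using F(2)[OF elim(2), of x] Q[OF elim(2)] unfolding nearest_point_map_def
          by (meson le_less_trans)
        from this[of x] this[of x'] have "dist x x' < 2 / real n"
          using dist_triangle2[of x x' "Q n x"] that by simp
        with elim(1) show ?thesis by simp
      qed
      have "discretized_mdp \<gamma> p (F n) (Q n) (\<nu> n) \<Lambda> \<alpha> \<epsilon>"
      proof (intro discretized_mdp.intro discretized_mdp_axioms.intro mdp.intro)
        show "\<gamma> \<in> space (prob_algebra borel)" "\<Lambda> \<in> space (prob_algebra borel)"
          using gam lam by (auto simp: space_prob_algebra)
        show "Q n \<in> borel \<rightarrow>\<^sub>M count_space (F n)"
          using Q[OF elim(2)] by (simp add: nearest_point_map_def)
        show "(1 - \<alpha>) * measure \<Lambda> D \<le> measure (p z) D" if "D \<in> sets borel" for z D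
          using mult_left_mono[OF minor(2)[of z], of "measure \<Lambda> D"] minor(1)[OF that, of z]
          by (simp add: mult.commute)
        show "tv_dist (p (x, a)) (p (x', a)) \<le> \<epsilon>" if "Q n x = Q n x'" for x x' a
          using near[OF that] by (intro p_osc) (simp add: dist_Pair_Pair \<eta>_def)
      qed (fact kernel F(1)[OF elim(2)] nu(1)[OF elim(2)] nu(2)[OF elim(2)] nu(3)[OF elim(2)]
          less_imp_le[OF al(1)] al(2))+
      then interpret discretized_mdp \<gamma> p "F n" "Q n" "\<nu> n" \<Lambda> \<alpha> \<epsilon> .
      have meas: "f \<in> borel_measurable (borel \<Otimes>\<^sub>M borel)" if "continuous_on UNIV f" for f :: "'x \<times> 'a \<Rightarrow> real"
        using borel_measurable_continuous_onI[OF that] by (simp add: borel_prod)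
      have "?gap n \<le> ereal (\<theta> * C + (3 + 3 * C / (1 - \<alpha>)) * \<epsilon>)"
      proof (rule constrained_values_close[OF \<epsilon>(1), where ?\<pi>0.0 = \<pi>0 and \<delta> = \<delta>])
        show "\<bar>c (x, a) - c (x', a)\<bar> \<le> \<epsilon>" if "Q n x = Q n x'" for x x' a
          using near[OF that] by (intro c_osc) (simp add: \<eta>_def)
        show "\<bar>d l (x, a) - d l (x', a)\<bar> \<le> \<epsilon>" if "l \<in> {1..q}" "Q n x = Q n x'" for l x x' a
          using near[OF that(2)] d_osc[OF that(1), of x x'] by (simp add: \<eta>_def)
        show "(3 + 3 * C / (1 - \<alpha>)) * \<epsilon> \<le> \<theta> * \<delta>"
          using \<epsilon>(2) by (simp add: K_def)
      qed (use C c d c_C d_C \<pi>0 slack \<theta> \<delta> meas in auto)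
      also have "\<dots> < ereal e"
        using \<theta>(3) \<epsilon>(3) e by (simp add: K_def)
      finally show ?case .
    qed
  qed
  note close = this
  show ?thesis
  proof (rule order_tendstoI)
    fix u :: ereal assume "u < 0"
    then show "\<forall>\<^sub>F n in sequentially. u < ?gap n"
      by (intro always_eventually allI) (erule less_le_trans, rule abs_ereal_pos)
  next
    fix u :: ereal assume "0 < u"
    then obtain e where e: "0 < e" "ereal e < u"
      using ereal_dense2[of 0 u] by (auto simp: zero_ereal_def)
    show "\<forall>\<^sub>F n in sequentially. ?gap n < u"
      using close[OF e(1)] by eventually_elim (rule less_trans[OF _ e(2)])
  qed
qed

end
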